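(* Let $r \le s \le t$ be positive integers such that (i) $t + 18 \le \frac{4rs}{r+s}$, (ii) $t \ne s+2$, and (iii) $r$, $s$ and $t$ have the same parity. Then the complete tripartite graph $K_{5r,5s,5t}$ can be decomposed into 5-cycles.
   Context: $K_{a,b,c}$ denotes the complete tripartite graph with partite sets of sizes $a$, $b$, $c$ (two vertices are adjacent if and only if they lie in different partite sets). A decomposition of a graph $G$ into 5-cycles is a partition of the edge set $E(G)$ into sets each of which is the edge set of a cycle of length 5 in $G$. *)

theory Defs
  imports Complex_Main "HOL-Library.Disjoint_Sets"
begin

text \<open>A simple graph is a pair of a vertex set and a set of edges, each edge being a
  two-element set of vertices.\<close>

type_synonym 'a graph = "'a set \<times> 'a set set"

abbreviation vertices :: "'a graph \<Rightarrow> 'a set" where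
  "vertices G \<equiv> fst G"

abbreviation edges :: "'a graph \<Rightarrow> 'a set set" where
  "edges G \<equiv> snd G"

text \<open>The vertex \<open>(p, j)\<close> of \<open>K\<^bsub>a,b,c\<^esub>\<close> is the \<open>j\<close>-th vertex of the \<open>p\<close>-th partite set.\<close>

definition tripartite_vertices :: "nat \<Rightarrow> nat \<Rightarrow> nat \<Rightarrow> (nat \<times> nat) set" where
  "tripartite_vertices a b c = {0} \<times> {..<a} \<union> {1} \<times> {..<b} \<union> {2} \<times> {..<c}"

definition complete_tripartite :: "nat \<Rightarrow> nat \<Rightarrow> nat \<Rightarrow> (nat \<times> nat) graph" where
  "complete_tripartite a b c =
    (tripartite_vertices a b c,
     {{u, v} | u v. u \<in> tripartite_vertices a b c \<and> v \<in> tripartite_vertices a b c \<and> fst u \<noteq> fst v})"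

definition closed_walk_edges :: "'a list \<Rightarrow> 'a set set" where
  "closed_walk_edges vs = {{vs ! i, vs ! (Suc i mod length vs)} | i. i < length vs}"

definition is_cycle_edge_set :: "nat \<Rightarrow> 'a graph \<Rightarrow> 'a set set \<Rightarrow> bool" where
  "is_cycle_edge_set k G F \<longleftrightarrow>
    k \<ge> 3 \<and> F \<subseteq> edges G \<and>
    (\<exists>vs. length vs = k \<and> distinct vs \<and> set vs \<subseteq> vertices G \<and> F = closed_walk_edges vs)"

definition cycle_decomposition :: "nat \<Rightarrow> 'a graph \<Rightarrow> 'a set set set \<Rightarrow> bool" where
  "cycle_decomposition k G D \<longleftrightarrow>
    partition_on (edges G) D \<and> (\<forall>F\<in>D. is_cycle_edge_set k G F)"

end

(*
  Blowing every vertex up into five independent copies turns a triangle or a 5-cycle into a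
  5-cycle-decomposable graph, so it suffices to decompose K_{r,s,t} into triangles and 5-cycles.

  The cells of an r x s Latin rectangle on t symbols are edge-disjoint triangles
  (row, column, symbol), and they miss only row-symbol and column-symbol edges.  Two triangles
  x y z and x' y' z together with a missed four-cycle y p y' q form the two 5-cycles x y p y' z and
  x' y' q y z.  Built from 2 x 2 subsquares on symbol pairs, the rectangle misses copies of
  K_{2,2} joining a pair of rows or a pair of columns to a pair of symbols, and the two cells of a
  subsquare that carry the same symbol can absorb one copy of either kind.  The inequality on
  t says that there is enough room for all copies, with some to spare.

  If r, s, t are odd, one exceptional row, column and symbol are added to the r div 2, s div 2,
  t div 2 pairs.  They are woven in along the main diagonal of subsquares, and what remains
  uncovered around them is again a union of triangles, 5-cycles and four-cycles that subsquares can
  absorb.  This needs s < t.  If s = t, the cyclic Latin rectangle works: the missed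
  column-symbol edges split into zigzag cycles, each of which is absorbed by a whole row.
*)
theory Submission
  imports Defs
begin

section \<open>Decompositions of edge sets into cycles\<close>

text \<open>Bare edge sets instead of graphs, so that parts of a graph can be decomposed separately.
  \<open>N\<close> holds the allowed lengths: \<open>{3, 5}\<close> before the blow-up,
  \<open>{5}\<close> after it.\<close>

definition cycle_decomposable :: "nat set \<Rightarrow> 'a set set \<Rightarrow> bool" where
  "cycle_decomposable N E \<longleftrightarrow>
    (\<exists>P. partition_on E P \<and>
      (\<forall>F\<in>P. \<exists>vs. length vs \<in> N \<and> distinct vs \<and> F = closed_walk_edges vs))"

definition cycle_edges :: "'a list \<Rightarrow> 'a set list" where
  "cycle_edges vs = map (\<lambda>(x, y). {x, y}) (zip vs (rotate1 vs))"

lemma closed_walk_edges_eq: "closed_walk_edges vs = set (cycle_edges vs)"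
  by (force simp: closed_walk_edges_def cycle_edges_def set_conv_nth nth_rotate1 case_prod_unfold)

lemma closed_walk_edges_map: "closed_walk_edges (map f vs) = (`) f ` closed_walk_edges vs"
  by (simp add: closed_walk_edges_eq cycle_edges_def rotate1_map zip_map_map image_image
      case_prod_unfold)

lemma set_subset_closed_walk_edges: "set vs \<subseteq> \<Union>(closed_walk_edges vs)"
proof
  fix v assume "v \<in> set vs"
  then obtain i where "i < length vs" "v = vs ! i"
    by (metis in_set_conv_nth)
  then have "{v, vs ! (Suc i mod length vs)} \<in> closed_walk_edges vs"
    unfolding closed_walk_edges_def by blast
  then show "v \<in> \<Union>(closed_walk_edges vs)" by blast
qed

lemma cycle_decomposable_empty: "cycle_decomposable N {}"
  unfolding cycle_decomposable_def by (rule exI[of _ "{}"]) (simp add: partition_on_empty)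

lemma cycle_decomposable_cycle:
  assumes "length vs \<in> N" "distinct vs"
  shows "cycle_decomposable N (closed_walk_edges vs)"
proof (cases "vs = []")
  case True
  then show ?thesis
    by (simp add: closed_walk_edges_def cycle_decomposable_empty)
next
  case False
  then have "closed_walk_edges vs \<noteq> {}"
    by (auto simp: closed_walk_edges_def)
  then show ?thesis
    unfolding cycle_decomposable_def using assms
    by (intro exI[of _ "{closed_walk_edges vs}"]) (auto simp: partition_on_space)
qed

lemma cycle_decomposable_UN:
  assumes "disjoint_family_on X I" "\<And>i. i \<in> I \<Longrightarrow> cycle_decomposable N (X i)"
  shows "cycle_decomposable N (\<Union>i\<in>I. X i)"
proof -
  obtain P where P: "\<And>i. i \<in> I \<Longrightarrow> partition_on (X i) (P i)"
    "\<And>i F. i \<in> I \<Longrightarrow> F \<in> P i \<Longrightarrow> \<exists>vs. length vs \<in> N \<and> distinct vs \<and> F = closed_walk_edges vs"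
    using assms(2) unfolding cycle_decomposable_def by metis
  have U: "\<Union>(P i) = X i" if "i \<in> I" for i
    using P(1)[OF that] by (simp add: partition_on_def)
  have "partition_on (\<Union>i\<in>I. X i) (\<Union>i\<in>I. P i)"
  proof (rule partition_onI)
    show "\<Union>(\<Union>i\<in>I. P i) = (\<Union>i\<in>I. X i)"
      using U by blast
    show "{} \<notin> (\<Union>i\<in>I. P i)"
      using P(1) by (auto simp: partition_on_def)
    fix p q assume "p \<in> (\<Union>i\<in>I. P i)" "q \<in> (\<Union>i\<in>I. P i)" "p \<noteq> q"
    then obtain i j where ij: "i \<in> I" "j \<in> I" "p \<in> P i" "q \<in> P j" by auto
    show "disjnt p q"
    proof (cases "i = j")
      case True
      then show ?thesis
        using P(1)[OF ij(1)] ij \<open>p \<noteq> q\<close> by (auto simp: partition_on_def pairwise_def disjnt_def)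
    next
      case False
      then have "X i \<inter> X j = {}"
        using assms(1) ij by (auto simp: disjoint_family_on_def)
      then show ?thesis
        using U ij by (auto simp: disjnt_def)
    qed
  qed
  then show ?thesis
    unfolding cycle_decomposable_def using P(2) by blast
qed

lemma cycle_decomposable_Un:
  assumes "cycle_decomposable N A" "cycle_decomposable N B" "A \<inter> B = {}"
  shows "cycle_decomposable N (A \<union> B)"
proof -
  have "cycle_decomposable N (\<Union>i\<in>UNIV. if i then A else B)"
    by (rule cycle_decomposable_UN) (use assms in \<open>auto simp: disjoint_family_on_def\<close>)
  then show ?thesis by (simp add: UNIV_bool Un_commute)
qed

text \<open>For an explicit list of cycles, edge-disjointness becomes a single distinctness
  condition that can be checked by computation.\<close>

lemma cycle_decomposable_list:
  assumes "distinct (concat (map cycle_edges css))"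
    and "\<forall>vs\<in>set css. length vs \<in> N \<and> distinct vs"
  shows "cycle_decomposable N (set (concat (map cycle_edges css)))"
  using assms
proof (induction css)
  case Nil
  then show ?case by (simp add: cycle_decomposable_empty)
next
  case (Cons vs css)
  then have "cycle_decomposable N (closed_walk_edges vs \<union> set (concat (map cycle_edges css)))"
    by (intro cycle_decomposable_Un cycle_decomposable_cycle) (auto simp: closed_walk_edges_eq)
  then show ?case by (simp add: closed_walk_edges_eq)
qed

lemma cycle_decomposable_image:
  assumes "inj_on f (\<Union>E)" "cycle_decomposable N E"
  shows "cycle_decomposable N ((`) f ` E)"
proof -
  obtain P where P: "partition_on E P"
    "\<And>F. F \<in> P \<Longrightarrow> \<exists>vs. length vs \<in> N \<and> distinct vs \<and> F = closed_walk_edges vs"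
    using assms(2) unfolding cycle_decomposable_def by metis
  have inj: "inj_on ((`) f) E"
    using assms(1) by (rule inj_on_image)
  have eq: "(`) f ` E = (\<Union>F\<in>P. (`) f ` F)"
    using partition_onD1[OF P(1)] by blast
  show ?thesis
    unfolding eq
  proof (rule cycle_decomposable_UN)
    show "disjoint_family_on (\<lambda>F. (`) f ` F) P"
      unfolding disjoint_family_on_def
    proof (intro ballI impI)
      fix F G assume FG: "F \<in> P" "G \<in> P" "F \<noteq> G"
      then have "F \<inter> G = {}" "F \<subseteq> E" "G \<subseteq> E"
        using P(1) by (auto simp: partition_on_def disjoint_def)
      then show "(`) f ` F \<inter> (`) f ` G = {}"
        using inj_on_image_Int[OF inj, of F G] by auto
    qed
    fix F assume F: "F \<in> P"
    then obtain vs where vs: "length vs \<in> N" "distinct vs" "F = closed_walk_edges vs"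
      using P(2) by blast
    have "set vs \<subseteq> \<Union>F"
      unfolding vs by (rule set_subset_closed_walk_edges)
    then have "set vs \<subseteq> \<Union>E"
      using F partition_onD1[OF P(1)] by blast
    then have "distinct (map f vs)"
      using assms(1) vs(2) by (meson distinct_map inj_on_subset)
    moreover have "(`) f ` F = closed_walk_edges (map f vs)"
      by (simp add: vs closed_walk_edges_map)
    ultimately show "cycle_decomposable N ((`) f ` F)"
      using cycle_decomposable_cycle[of "map f vs" N] vs(1) by simp
  qed
qed

section \<open>Blow-ups by five independent copies of each vertex\<close>

definition blow_up :: "'a set set \<Rightarrow> ('a \<times> nat) set set" where
  "blow_up E = {{(u, x), (v, y)} | u v x y. {u, v} \<in> E \<and> x < 5 \<and> y < 5}"

text \<open>Renaming vertices commutes with blowing up, so explicit decompositions are needed only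
  for the cycles on \<open>0, 1, 2\<close> and on \<open>0, 1, 2, 3, 4\<close>.\<close>

lemma blow_up_image:
  assumes "inj_on f (\<Union>E)"
  shows "blow_up ((`) f ` E) = (`) (map_prod f id) ` blow_up E"
proof
  show "blow_up ((`) f ` E) \<subseteq> (`) (map_prod f id) ` blow_up E"
  proof
    fix e assume "e \<in> blow_up ((`) f ` E)"
    then obtain u v x y d where *: "e = {(u, x), (v, y)}" "{u, v} = f ` d" "d \<in> E" "x < 5" "y < 5"
      by (auto simp: blow_up_def)
    then obtain u' v' where uv: "u' \<in> d" "v' \<in> d" "u = f u'" "v = f v'"
      by (metis imageE insertI1 insert_commute)
    then have "f ` d = f ` {u', v'}"
      using * by simp
    moreover have "d \<subseteq> \<Union>E" "{u', v'} \<subseteq> \<Union>E"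
      using uv *(3) by auto
    ultimately have "d = {u', v'}"
      using inj_on_image_eq_iff[OF assms] by blast
    then have "{(u', x), (v', y)} \<in> blow_up E"
      using * by (auto simp: blow_up_def)
    moreover have "e = map_prod f id ` {(u', x), (v', y)}"
      using * uv by simp
    ultimately show "e \<in> (`) (map_prod f id) ` blow_up E"
      by blast
  qed
  show "(`) (map_prod f id) ` blow_up E \<subseteq> blow_up ((`) f ` E)"
  proof (rule image_subsetI)
    fix e assume "e \<in> blow_up E"
    then obtain u v x y where *: "e = {(u, x), (v, y)}" "{u, v} \<in> E" "x < 5" "y < 5"
      by (auto simp: blow_up_def)
    then have "map_prod f id ` e = {(f u, x), (f v, y)}" "{f u, f v} \<in> (`) f ` E"
      by (auto intro: image_eqI[where x = "{u, v}"])
    then show "map_prod f id ` e \<in> blow_up ((`) f ` E)"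
      unfolding blow_up_def using *(3,4) by blast
  qed
qed

lemma blow_upI: "{u, v} \<in> E \<Longrightarrow> x < 5 \<Longrightarrow> y < 5 \<Longrightarrow> {(u, x), (v, y)} \<in> blow_up E"
  unfolding blow_up_def by blast

lemma complete_tripartite_edgeI:
  "u \<in> tripartite_vertices r s t \<Longrightarrow> v \<in> tripartite_vertices r s t \<Longrightarrow> fst u \<noteq> fst v \<Longrightarrow>
    {u, v} \<in> edges (complete_tripartite r s t)"
  unfolding complete_tripartite_def snd_conv by blast

lemma complete_tripartite_edgeD:
  "{u, v} \<in> edges (complete_tripartite r s t) \<Longrightarrow>
    u \<in> tripartite_vertices r s t \<and> v \<in> tripartite_vertices r s t \<and> fst u \<noteq> fst v"
  by (auto simp: complete_tripartite_def doubleton_eq_iff)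

lemma Union_closed_walk_edges: "\<Union>(closed_walk_edges vs) = set vs"
proof
  show "\<Union>(closed_walk_edges vs) \<subseteq> set vs"
  proof
    fix v assume "v \<in> \<Union>(closed_walk_edges vs)"
    then obtain i where "i < length vs" "v = vs ! i \<or> v = vs ! (Suc i mod length vs)"
      by (auto simp: closed_walk_edges_def)
    moreover from this have "Suc i mod length vs < length vs"
      by (intro mod_less_divisor) auto
    ultimately show "v \<in> set vs"
      by auto
  qed
qed (rule set_subset_closed_walk_edges)

lemma blow_up_closed_walk_edges:
  "blow_up (closed_walk_edges vs) =
    (\<Union>(u, v)\<in>set (zip vs (rotate1 vs)). (\<lambda>(x, y). {(u, x), (v, y)}) ` ({..<5} \<times> {..<5}))"
  (is "?l = ?r")
proof
  show "?l \<subseteq> ?r"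
  proof
    fix e assume "e \<in> ?l"
    then obtain u v x y where *: "e = {(u, x), (v, y)}" "{u, v} \<in> closed_walk_edges vs" "x < 5" "y < 5"
      by (auto simp: blow_up_def)
    then have "(u, v) \<in> set (zip vs (rotate1 vs)) \<or> (v, u) \<in> set (zip vs (rotate1 vs))"
      by (auto simp: closed_walk_edges_eq cycle_edges_def doubleton_eq_iff)
    moreover have "e \<in> (\<lambda>(x, y). {(u, x), (v, y)}) ` ({..<5} \<times> {..<5})"
      "e \<in> (\<lambda>(x, y). {(v, x), (u, y)}) ` ({..<5} \<times> {..<5})"
      by (rule image_eqI[of _ _ "(x, y)"], use *(1,3,4) in simp_all)
        (rule image_eqI[of _ _ "(y, x)"], use *(1,3,4) in \<open>simp_all add: insert_commute\<close>)
    ultimately show "e \<in> ?r"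
      by (elim disjE) (rule UN_I, assumption, simp only: prod.case)+
  qed
  have uv: "{u, v} \<in> closed_walk_edges vs" if "(u, v) \<in> set (zip vs (rotate1 vs))" for u v
    using that by (auto simp: closed_walk_edges_eq cycle_edges_def intro: image_eqI[of _ _ "(u, v)"])
  show "?r \<subseteq> ?l"
  proof (clarsimp simp del: set_zip)
    fix u v x y assume "(u, v) \<in> set (zip vs (rotate1 vs))" "x < (5::nat)" "y < (5::nat)"
    then show "{(u, x), (v, y)} \<in> blow_up (closed_walk_edges vs)"
      unfolding blow_up_def using uv by blast
  qed
qed

lemma less_5_nat: "{..<5} = {0, 1, 2, 3, 4::nat}"
  by auto

text \<open>Between them, the edges of the three cycles for \<open>g = 0\<close> realise each of the five differences
  modulo 5 between each two parts once.\<close>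

lemma cycle_decomposable_blow_up_triangle_nat:
  "cycle_decomposable {5} (blow_up (closed_walk_edges [0, 1, 2::nat]))"
proof -
  let ?css = "concat (map (\<lambda>g. 
    [[(0, g), (1, g), (0, (3 + g) mod 5), (1, (4 + g) mod 5), (2, (2 + g) mod 5)],
     [(0, g), (2, (1 + g) mod 5), (0, (3 + g) mod 5), (2, (3 + g) mod 5), (1, (3 + g) mod 5)],
     [(1, g), (2, (2 + g) mod 5), (1, (1 + g) mod 5), (2, g), (0, (1 + g) mod 5)]]) [0, 1, 2, 3, 4])
    :: (nat \<times> nat) list list"
  have "cycle_decomposable {5} (set (concat (map cycle_edges ?css)))"
    by (rule cycle_decomposable_list) (simp_all add: cycle_edges_def doubleton_eq_iff)
  moreover have "set (concat (map cycle_edges ?css)) = blow_up (closed_walk_edges [0, 1, 2::nat])"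
  proof
    show "set (concat (map cycle_edges ?css)) \<subseteq> blow_up (closed_walk_edges [0, 1, 2::nat])"
      by (simp add: cycle_edges_def blow_up_closed_walk_edges less_5_nat doubleton_eq_iff)
    show "blow_up (closed_walk_edges [0, 1, 2::nat]) \<subseteq> set (concat (map cycle_edges ?css))"
      by (simp add: cycle_edges_def blow_up_closed_walk_edges less_5_nat doubleton_eq_iff)
  qed
  ultimately show ?thesis by simp
qed

lemma add_mod_cancel_less:
  fixes x y z :: nat
  assumes "(x + z) mod n = (y + z) mod n" "x < n" "y < n"
  shows "x = y"
  using assms
proof (induction x y rule: linorder_wlog)
  case (le x y)
  then have "n dvd y - x"
    using mod_eq_dvd_iff_nat[of "x + z" "y + z" n] by simp
  then show ?case
    using le by (metis diff_is_0_eq dvd_imp_le less_imp_diff_less not_le zero_less_iff_neq_zero le_antisym)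
qed auto

text \<open>The 25 cycles carry the labels x, y, x + y, x, y modulo 5. Any two cyclically
  consecutive labels determine x and y, so each of the 25 copies of an edge of the pentagon lies in
  exactly one cycle.\<close>

lemma cycle_decomposable_blow_up_pentagon_nat:
  "cycle_decomposable {5} (blow_up (closed_walk_edges [0, 1, 2, 3, 4::nat]))"
proof -
  define C :: "nat \<times> nat \<Rightarrow> (nat \<times> nat) list"
    where "C = (\<lambda>(x, y). [(0, x), (1, y), (2, (x + y) mod 5), (3, x), (4, y)])"
  have C: "closed_walk_edges (C (x, y)) =
     {{(0, x), (1, y)}, {(1, y), (2, (x + y) mod 5)}, {(2, (x + y) mod 5), (3, x)},
      {(3, x), (4, y)}, {(4, y), (0, x)}}" for x y
    by (simp add: C_def closed_walk_edges_eq cycle_edges_def)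
  have "cycle_decomposable {5} (\<Union>p\<in>{..<5}\<times>{..<5}. closed_walk_edges (C p))"
  proof (rule cycle_decomposable_UN)
    show "disjoint_family_on (\<lambda>p. closed_walk_edges (C p)) ({..<5} \<times> {..<5})"
      unfolding disjoint_family_on_def
    proof (intro ballI impI equals0I)
      fix p q e
      assume "p \<in> {..<5} \<times> {..<5::nat}" "q \<in> {..<5} \<times> {..<5::nat}" and pq: "p \<noteq> q"
        and e: "e \<in> closed_walk_edges (C p) \<inter> closed_walk_edges (C q)"
      then obtain x y x' y' where xy: "p = (x, y)" "q = (x', y')" "x < 5" "y < 5" "x' < 5" "y' < 5"
        by fastforce
      have "(x + y) mod 5 = (x' + y) mod 5 \<longleftrightarrow> x = x'" "(x + y) mod 5 = (x + y') mod 5 \<longleftrightarrow> y = y'"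
        using xy add_mod_cancel_less[of x y 5 x'] add_mod_cancel_less[of y x 5 y']
        by (auto simp: add.commute)
      then have *: "y = y' \<and> (x + y) mod 5 = (x' + y') mod 5 \<longleftrightarrow> x = x' \<and> y = y'"
        "(x + y) mod 5 = (x' + y') mod 5 \<and> x = x' \<longleftrightarrow> x = x' \<and> y = y'"
        by auto
      have "x = x' \<and> y = y'"
        using e unfolding xy C Int_iff
        by (elim conjE insertE emptyE) (simp_all add: doubleton_eq_iff *)
      then show False
        using pq xy by simp
    qed
    show "cycle_decomposable {5} (closed_walk_edges (C p))" for p
      by (rule cycle_decomposable_cycle) (auto simp: C_def split: prod.splits)
  qed
  moreover have "(\<Union>p\<in>{..<5}\<times>{..<5}. closed_walk_edges (C p)) =
      blow_up (closed_walk_edges [0, 1, 2, 3, 4::nat])"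
  proof
    show "(\<Union>p\<in>{..<5}\<times>{..<5}. closed_walk_edges (C p)) \<subseteq>
      blow_up (closed_walk_edges [0, 1, 2, 3, 4::nat])"
    proof clarify
      fix e x y assume "e \<in> closed_walk_edges (C (x, y))" "x < 5" "y < 5"
      then show "e \<in> blow_up (closed_walk_edges [0, 1, 2, 3, 4::nat])"
        unfolding C
        by (elim insertE emptyE; simp only:)
          (intro blow_upI; simp add: closed_walk_edges_eq cycle_edges_def)+
    qed
    have surj: "\<exists>y'<5. (x + y') mod 5 = y" if "x < 5" "y < 5" for x y :: nat
      by (rule exI[of _ "if x \<le> y then y - x else y + 5 - x"]) (use that in auto)
    have "e \<in> (\<Union>p\<in>{..<5}\<times>{..<5}. closed_walk_edges (C p))"
      if e: "e = {(u, x), (v, y)}" and uv: "(u, v) \<in> {(0, 1), (1, 2), (2, 3), (3, 4), (4, 0)}"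
        and xy: "x < 5" "y < 5" for e u v x y
    proof -
      \<comment> \<open>\<open>x'\<close> recovers the cycle from an edge whose second label is the
        sum, \<open>y'\<close> from an edge whose first label is the sum.\<close>
      obtain x' where x': "x' < 5" "(x + x') mod 5 = y" "(x' + x) mod 5 = y" using surj xy by (metis add.commute)
      obtain y' where y': "y' < 5" "(y + y') mod 5 = x" using surj xy by blast
      consider "u = 0" "v = 1" | "u = 1" "v = 2" | "u = 2" "v = 3" | "u = 3" "v = 4" | "u = 4" "v = 0"
        using uv by auto
      then have "e \<in> closed_walk_edges (C (x, y)) \<union> closed_walk_edges (C (y, x)) \<union>
         closed_walk_edges (C (x', x)) \<union> closed_walk_edges (C (y, y'))"
        by cases (simp_all add: e C x' y')
      then show ?thesis using xy x' y' by blast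
    qed
    note * = this
    show "blow_up (closed_walk_edges [0, 1, 2, 3, 4::nat]) \<subseteq>
        (\<Union>p\<in>{..<5}\<times>{..<5}. closed_walk_edges (C p))"
    proof
      fix e assume "e \<in> blow_up (closed_walk_edges [0, 1, 2, 3, 4::nat])"
      then obtain u v x y
        where "(u, v) \<in> set (zip [0, 1, 2, 3, 4::nat] (rotate1 [0, 1, 2, 3, 4]))"
          "x < 5" "y < 5" "e = {(u, x), (v, y)}"
        unfolding blow_up_closed_walk_edges by blast
      then show "e \<in> (\<Union>p\<in>{..<5}\<times>{..<5}. closed_walk_edges (C p))"
        by (intro *[of e u x v y]) simp_all
    qed
  qed
  ultimately show ?thesis by simp
qed

lemma cycle_decomposable_blow_up_cycle:
  assumes "length vs \<in> {3, 5}" "distinct vs"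
  shows "cycle_decomposable {5} (blow_up (closed_walk_edges vs))"
proof -
  have vs: "vs = map ((!) vs) [0..<length vs]"
    by (simp add: map_nth)
  have *: "cycle_decomposable {5} (blow_up (closed_walk_edges [0..<length vs]))"
  proof -
    have "[0..<3] = [0, 1, 2::nat]" "[0..<5] = [0, 1, 2, 3, 4::nat]"
      by (simp_all add: upt_rec)
    then show ?thesis
      using assms(1) cycle_decomposable_blow_up_triangle_nat cycle_decomposable_blow_up_pentagon_nat
      by (elim insertE emptyE) simp_all
  qed
  have ub: "\<Union>(closed_walk_edges [0..<length vs]) \<subseteq> {..<length vs}"
    by (simp add: Union_closed_walk_edges atLeast0LessThan)
  have inj: "inj_on ((!) vs) {..<length vs}"
    using assms(2) by (simp add: inj_on_nth)
  have "blow_up (closed_walk_edges vs) =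
      (`) (map_prod ((!) vs) id) ` blow_up (closed_walk_edges [0..<length vs])"
    by (subst vs, subst closed_walk_edges_map)
      (rule blow_up_image, rule inj_on_subset[OF inj ub])
  moreover have "cycle_decomposable {5} \<dots>"
  proof (rule cycle_decomposable_image[OF _ *])
    have "\<Union>(blow_up (closed_walk_edges [0..<length vs])) \<subseteq> {..<length vs} \<times> UNIV"
      using ub by (fastforce simp: blow_up_def)
    moreover have "inj_on (map_prod ((!) vs) (id :: nat \<Rightarrow> nat)) ({..<length vs} \<times> UNIV)"
      using inj by (auto simp: inj_on_def)
    ultimately show "inj_on (map_prod ((!) vs) id) (\<Union>(blow_up (closed_walk_edges [0..<length vs])))"
      by (rule inj_on_subset[rotated])
  qed
  ultimately show ?thesis by simp
qed

text \<open>Projecting a blown-up edge by \<open>fst\<close> returns the original edge, so disjoint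
  cycles have disjoint blow-ups.\<close>

lemma cycle_decomposable_blow_up:
  assumes "cycle_decomposable {3, 5} E"
  shows "cycle_decomposable {5} (blow_up E)"
proof -
  obtain P where P: "partition_on E P"
    "\<And>F. F \<in> P \<Longrightarrow> \<exists>vs. length vs \<in> {3, 5} \<and> distinct vs \<and> F = closed_walk_edges vs"
    using assms unfolding cycle_decomposable_def by metis
  have "blow_up E = (\<Union>F\<in>P. blow_up F)"
    unfolding partition_onD1[OF P(1)] blow_up_def by blast
  moreover have "cycle_decomposable {5} \<dots>"
  proof (rule cycle_decomposable_UN)
    have "F = G" if F: "F \<in> P" "e \<in> blow_up F" and G: "G \<in> P" "e \<in> blow_up G" for F G e
    proof -
      have "fst ` e \<in> F" "fst ` e \<in> G"
        using F G by (auto simp: blow_up_def)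
      then show "F = G"
        using F G P(1) by (auto simp: partition_on_def disjoint_def)
    qed
    then show "disjoint_family_on blow_up P"
      by (auto simp: disjoint_family_on_def)
    show "cycle_decomposable {5} (blow_up F)" if "F \<in> P" for F
      using P(2)[OF that] cycle_decomposable_blow_up_cycle by blast
  qed
  ultimately show ?thesis by simp
qed

lemma cycle_decomposition_blow_up_tripartite:
  assumes "cycle_decomposable {3, 5} (edges (complete_tripartite r s t))"
  shows "\<exists>D. cycle_decomposition 5 (complete_tripartite (5 * r) (5 * s) (5 * t)) D"
proof -
  define f where "f = (\<lambda>((p, j), x). (p :: nat, 5 * j + x :: nat))"
  let ?E = "blow_up (edges (complete_tripartite r s t))"
  have V: "v \<in> tripartite_vertices (5 * r) (5 * s) (5 * t) \<longleftrightarrow>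
     (\<exists>u x. u \<in> tripartite_vertices r s t \<and> x < 5 \<and> v = f (u, x))" (is "?P \<longleftrightarrow> ?Q") for v
  proof
    assume ?P
    then have "(fst v, snd v div 5) \<in> tripartite_vertices r s t" "v = f ((fst v, snd v div 5), snd v mod 5)"
      by (auto simp: tripartite_vertices_def f_def)
    then show ?Q
      using mod_less_divisor[of 5 "snd v"] by (metis zero_less_numeral)
  next
    assume ?Q
    then show ?P by (auto simp: tripartite_vertices_def f_def)
  qed
  have E: "edges (complete_tripartite (5 * r) (5 * s) (5 * t)) = (`) f ` ?E" (is "?l = ?r")
  proof
    show "?l \<subseteq> ?r"
    proof
      fix e assume "e \<in> ?l"
      then obtain u v where e: "e = {u, v}" "fst u \<noteq> fst v"
        "u \<in> tripartite_vertices (5 * r) (5 * s) (5 * t)" "v \<in> tripartite_vertices (5 * r) (5 * s) (5 * t)"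
        by (auto simp: complete_tripartite_def)
      then obtain u' v' x y where *: "u' \<in> tripartite_vertices r s t" "v' \<in> tripartite_vertices r s t"
        "x < 5" "y < 5" "u = f (u', x)" "v = f (v', y)"
        unfolding V by blast
      moreover have "fst u' \<noteq> fst v'"
        using e(2) * by (auto simp: f_def split: prod.splits)
      ultimately have "{(u', x), (v', y)} \<in> ?E"
        by (intro blow_upI complete_tripartite_edgeI)
      moreover have "e = f ` {(u', x), (v', y)}"
        using e * by simp
      ultimately show "e \<in> ?r" by blast
    qed
    show "?r \<subseteq> ?l"
    proof (rule image_subsetI)
      fix e assume "e \<in> ?E"
      then obtain u v x y where *: "e = {(u, x), (v, y)}" "u \<in> tripartite_vertices r s t"
        "v \<in> tripartite_vertices r s t" "fst u \<noteq> fst v" "x < 5" "y < 5"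
        unfolding blow_up_def using complete_tripartite_edgeD by blast
      then have "f ` e = {f (u, x), f (v, y)}" "fst (f (u, x)) \<noteq> fst (f (v, y))"
        "f (u, x) \<in> tripartite_vertices (5 * r) (5 * s) (5 * t)"
        "f (v, y) \<in> tripartite_vertices (5 * r) (5 * s) (5 * t)"
        unfolding V by (auto simp: f_def split: prod.splits)
      then show "f ` e \<in> ?l"
        by (simp add: complete_tripartite_edgeI)
    qed
  qed
  have "inj_on f (UNIV \<times> {..<5})"
    by (auto simp: inj_on_def f_def) presburger+
  moreover have "\<Union>?E \<subseteq> UNIV \<times> {..<5}"
    by (auto simp: blow_up_def)
  ultimately have "inj_on f (\<Union>?E)"
    by (rule inj_on_subset)
  then have "cycle_decomposable {5} (edges (complete_tripartite (5 * r) (5 * s) (5 * t)))"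
    unfolding E by (rule cycle_decomposable_image) (rule cycle_decomposable_blow_up[OF assms])
  then obtain D where D: "partition_on (edges (complete_tripartite (5 * r) (5 * s) (5 * t))) D"
    "\<And>F. F \<in> D \<Longrightarrow> \<exists>vs. length vs = 5 \<and> distinct vs \<and> F = closed_walk_edges vs"
    unfolding cycle_decomposable_def by auto
  have "is_cycle_edge_set 5 (complete_tripartite (5 * r) (5 * s) (5 * t)) F" if F: "F \<in> D" for F
  proof -
    obtain vs where vs: "length vs = 5" "distinct vs" "F = closed_walk_edges vs"
      using D(2)[OF F] by blast
    have sub: "F \<subseteq> edges (complete_tripartite (5 * r) (5 * s) (5 * t))"
      using partition_onD1[OF D(1)] F by blast
    have "set vs \<subseteq> vertices (complete_tripartite (5 * r) (5 * s) (5 * t))"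
    proof
      fix v assume "v \<in> set vs"
      then have "v \<in> \<Union>F"
        unfolding vs(3) by (rule subsetD[OF set_subset_closed_walk_edges])
      then show "v \<in> vertices (complete_tripartite (5 * r) (5 * s) (5 * t))"
        using sub by (auto simp: complete_tripartite_def)
    qed
    then show ?thesis
      unfolding is_cycle_edge_set_def using vs sub by auto
  qed
  then show ?thesis
    unfolding cycle_decomposition_def using D(1) by blast
qed

section \<open>Rows, columns and symbols as the three parts; the case of two equal larger
  parts\<close>

definition row_col :: "nat \<Rightarrow> nat \<Rightarrow> (nat \<times> nat) set" where "row_col i j = {(0, i), (1, j)}"
definition row_sym :: "nat \<Rightarrow> nat \<Rightarrow> (nat \<times> nat) set" where "row_sym i k = {(0, i), (2, k)}"
definition col_sym :: "nat \<Rightarrow> nat \<Rightarrow> (nat \<times> nat) set" where "col_sym j k = {(1, j), (2, k)}"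

lemma edge_eq_iff [simp]:
  "row_col i j = row_col i' j' \<longleftrightarrow> i = i' \<and> j = j'"
  "row_sym i k = row_sym i' k' \<longleftrightarrow> i = i' \<and> k = k'"
  "col_sym j k = col_sym j' k' \<longleftrightarrow> j = j' \<and> k = k'"
  "row_col i j \<noteq> row_sym i' k" "row_sym i' k \<noteq> row_col i j"
  "row_col i j \<noteq> col_sym j' k" "col_sym j' k \<noteq> row_col i j"
  "row_sym i k \<noteq> col_sym j k'" "col_sym j k' \<noteq> row_sym i k"
  by (auto simp: row_col_def row_sym_def col_sym_def doubleton_eq_iff)

lemma edges_complete_tripartite:
  "edges (complete_tripartite r s t) =
    case_prod row_col ` ({..<r} \<times> {..<s}) \<union> case_prod row_sym ` ({..<r} \<times> {..<t}) \<union>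
    case_prod col_sym ` ({..<s} \<times> {..<t})" (is "?l = ?r")
proof
  show "?r \<subseteq> ?l"
    by (auto simp: row_col_def row_sym_def col_sym_def tripartite_vertices_def
        intro!: complete_tripartite_edgeI)
  show "?l \<subseteq> ?r"
  proof
    fix e assume "e \<in> ?l"
    then obtain u v where "e = {u, v}" "fst u \<noteq> fst v"
      "u \<in> tripartite_vertices r s t" "v \<in> tripartite_vertices r s t"
      unfolding complete_tripartite_def snd_conv by blast
    then obtain u v where e: "e = {u, v}" "fst u < fst v"
      "u \<in> tripartite_vertices r s t" "v \<in> tripartite_vertices r s t"
      by (metis insert_commute nat_neq_iff)
    obtain p x q y where "u = (p, x)" "v = (q, y)"
      by fastforce
    with e consider "u = (0, x)" "v = (1, y)" "x < r" "y < s" | "u = (0, x)" "v = (2, y)" "x < r" "y < t"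
      | "u = (1, x)" "v = (2, y)" "x < s" "y < t"
      by (auto simp: tripartite_vertices_def)
    then show "e \<in> ?r"
    proof cases
      case 1
      then have "e = case_prod row_col (x, y)" by (simp add: e row_col_def)
      with 1 show ?thesis by blast
    next
      case 2
      then have "e = case_prod row_sym (x, y)" by (simp add: e row_sym_def)
      with 2 show ?thesis by blast
    next
      case 3
      then have "e = case_prod col_sym (x, y)" by (simp add: e col_sym_def)
      with 3 show ?thesis by blast
    qed
  qed
qed

text \<open>In the rectangle with symbol \<open>i + j\<close> modulo \<open>t\<close> in cell \<open>(i, j)\<close>, the missed column-symbol
  edges have difference at least \<open>r\<close>. Those of differences \<open>r + 2i\<close> and \<open>r + 2i + 1\<close> form the
  zigzag that is absorbed by row \<open>i\<close>.\<close>

lemma cycle_decomposable_tripartite_equal: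
  assumes "r \<le> t" "even (t - r)" "t \<le> 3 * r" "2 \<le> t"
  shows "cycle_decomposable {3, 5} (edges (complete_tripartite r t t))"
proof -
  define diag where "diag d j = col_sym j ((d + j) mod t)" for d j
  \<comment> \<open>Cell \<open>(i, l)\<close> gives the triangle of row \<open>i\<close>, column
    \<open>l\<close> and symbol \<open>i + l\<close>. In an absorbing row, its edge between row
    \<open>i\<close> and column \<open>l\<close> is replaced by two zigzag edges leading to column
    \<open>l + 1\<close> and the edge from there to row \<open>i\<close>. Over all \<open>l\<close>,
    each edge between row \<open>i\<close> and a column is still used once.\<close>
  define W where "W = (\<lambda>(i, l). if r + 2 * i + 1 < t
    then [(2, (i + l) mod t), (1, l), (2, (r + 2 * i + 1 + l) mod t), (1, Suc l mod t), (0, i)]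
    else [(0, i), (1, l), (2::nat, (i + l) mod t)])"
  have W: "closed_walk_edges (W (i, l)) = (if r + 2 * i + 1 < t
      then {diag i l, diag (r + 2 * i + 1) l, diag (r + 2 * i) (Suc l mod t),
        row_col i (Suc l mod t), row_sym i ((i + l) mod t)}
      else {row_col i l, diag i l, row_sym i ((i + l) mod t)})" for i l
  proof -
    have "(r + 2 * i + Suc l mod t) mod t = (r + 2 * i + 1 + l) mod t"
      by (simp add: mod_add_right_eq)
    then show ?thesis
      by (auto simp: W_def closed_walk_edges_eq cycle_edges_def diag_def row_col_def row_sym_def
          col_sym_def insert_commute)
  qed
  have inj1: "Suc l mod t = Suc l' mod t \<longleftrightarrow> l = l'" if "l < t" "l' < t" for l l'
    using add_mod_cancel_less[of l 1 t l'] that by auto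
  have inj2: "(i + l) mod t = (i + l') mod t \<longleftrightarrow> l = l'" if "l < t" "l' < t" for i l l'
    using add_mod_cancel_less[of l i t l'] that by (auto simp: add.commute)
  have diag_eq: "diag d j = diag d' j' \<longleftrightarrow> d = d' \<and> j = j'" if "d < t" "d' < t" for d d' j j'
    using add_mod_cancel_less[of d j t d'] that by (auto simp: diag_def)
  have diag_neq: "diag d j \<noteq> row_col i j'" "diag d j \<noteq> row_sym i k"
    "row_col i j' \<noteq> diag d j" "row_sym i k \<noteq> diag d j" for d j i j' k
    by (simp_all add: diag_def)
  have "cycle_decomposable {3, 5} (\<Union>p\<in>{..<r} \<times> {..<t}. closed_walk_edges (W p))"
  proof (rule cycle_decomposable_UN)
    show "disjoint_family_on (\<lambda>p. closed_walk_edges (W p)) ({..<r} \<times> {..<t})"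
      unfolding disjoint_family_on_def
    proof (intro ballI impI equals0I)
      fix p q e
      assume "p \<in> {..<r} \<times> {..<t}" "q \<in> {..<r} \<times> {..<t}" and pq: "p \<noteq> q"
        and e: "e \<in> closed_walk_edges (W p) \<inter> closed_walk_edges (W q)"
      then obtain i l i' l' where il: "p = (i, l)" "q = (i', l')" "i < r" "l < t" "i' < r" "l' < t"
        by fastforce
      have "i < t" "i' < t" "2 * i \<noteq> Suc (2 * i')" "2 * i' \<noteq> Suc (2 * i)" "Suc (2 * i) \<noteq> 2 * i'"
        using il assms(1) by presburger+
      then have "i = i' \<and> l = l'"
        using e il(3-6) unfolding il(1,2) W Int_iff
        by (auto split: if_splits simp: diag_eq diag_neq inj1 inj2)
      then show False
        using pq il by simp
    qed
    fix p assume "p \<in> {..<r} \<times> {..<t}"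
    moreover have "l \<noteq> Suc l mod t" if "l < t" for l
      using that assms(4) by (simp add: mod_Suc)
    moreover have "(i + l) mod t \<noteq> Suc (r + 2 * i + l) mod t" if "i < r" "Suc (r + 2 * i) < t" for i l
      using add_mod_cancel_less[of i l t "Suc (r + 2 * i)"] that by auto
    ultimately show "cycle_decomposable {3, 5} (closed_walk_edges (W p))"
      by (intro cycle_decomposable_cycle) (auto simp: W_def split: if_splits)
  qed
  moreover have "(\<Union>p\<in>{..<r} \<times> {..<t}. closed_walk_edges (W p)) = edges (complete_tripartite r t t)"
    (is "?l = ?r")
  proof
    have "row_col i j \<in> ?r" "row_sym i j \<in> ?r" if "i < r" "j < t" for i j
      using that unfolding edges_complete_tripartite by force+
    moreover have "diag d j \<in> ?r" if "j < t" for d j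
      using that assms(4) unfolding edges_complete_tripartite diag_def by force
    ultimately show "?l \<subseteq> ?r"
      using assms(4) by (auto simp: W split: if_splits)
    have mem: "e \<in> ?l" if "e \<in> closed_walk_edges (W (i, l))" "i < r" "l < t" for e i l
      using that by blast
    have "row_col i j \<in> ?l" if "i < r" "j < t" for i j
    proof (cases "r + 2 * i + 1 < t")
      case True
      define l where "l = (if j = 0 then t - 1 else j - 1)"
      have "l < t" "j = Suc l mod t"
        using that by (auto simp: l_def)
      then show ?thesis
        using True that by (intro mem[of _ i l]) (auto simp: W)
    next
      case False
      then show ?thesis
        using that by (intro mem[of _ i j]) (auto simp: W)
    qed
    moreover have "row_sym i k \<in> ?l" if "i < r" "k < t" for i k
    proof -
      define l where "l = (if i \<le> k then k - i else k + t - i)"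
      have "l < t" "k = (i + l) mod t"
        using that assms(1) by (auto simp: l_def)
      then show ?thesis
        using that by (intro mem[of _ i l]) (auto simp: W)
    qed
    moreover have "col_sym j k \<in> ?l" if "j < t" "k < t" for j k
    proof -
      define d where "d = (if j \<le> k then k - j else k + t - j)"
      have d: "d < t" "k = (d + j) mod t"
        using that by (auto simp: d_def)
      then have "col_sym j k = diag d j"
        by (simp add: diag_def)
      \<comment> \<open>Differences below \<open>r\<close> belong to cells. The others come in pairs
        \<open>r + 2 * i\<close>, \<open>r + 2 * i + 1\<close>, and \<open>t \<le> 3 * r\<close>
        ensures that row \<open>i\<close> exists.\<close>
      moreover consider "d < r" | i where "d = r + 2 * i + 1" | i where "d = r + 2 * i"
        using le_add_diff_inverse[of r d] by (metis evenE oddE not_le add.assoc)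
      then have "diag d j \<in> ?l"
      proof cases
        case 1
        then show ?thesis
          using that by (intro mem[of _ d j]) (auto simp: W)
      next
        case (2 i)
        then show ?thesis
          using that d assms(3) by (intro mem[of _ i j]) (auto simp: W)
      next
        case (3 i)
        define l where "l = (if j = 0 then t - 1 else j - 1)"
        have l: "l < t" "j = Suc l mod t"
          using that by (auto simp: l_def)
        \<comment> \<open>The number \<open>t - r\<close> of missed differences is even, so the last
          one is not left without a partner.\<close>
        have "r + 2 * i + 1 \<noteq> t"
          using assms(2) by auto
        then have "r + 2 * i + 1 < t"
          using 3 d by simp
        then show ?thesis
          using 3 l assms(3) by (intro mem[of _ i l]) (auto simp: W)
      qed
      ultimately show ?thesis by simp
    qed
    ultimately show "?r \<subseteq> ?l"
      unfolding edges_complete_tripartite by auto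
  qed
  ultimately show ?thesis by simp
qed

section \<open>Absorbing four-cycles into triangles, and sharing out the absorbers\<close>

definition triangle :: "'a \<Rightarrow> 'a \<Rightarrow> 'a \<Rightarrow> 'a set set" where
  "triangle x y z = {{x, y}, {y, z}, {x, z}}"

definition bipartite :: "'a set \<Rightarrow> 'a set \<Rightarrow> 'a set set" where
  "bipartite A B = {{x, y} | x y. x \<in> A \<and> y \<in> B}"

lemma bipartite_pairs: "bipartite {x, y} {p, q} = {{x, p}, {x, q}, {y, p}, {y, q}}"
  unfolding bipartite_def by blast

lemma cycle_decomposable_triangle:
  "distinct [x, y, z] \<Longrightarrow> cycle_decomposable {3, 5} (triangle x y z)"
  using cycle_decomposable_cycle[of "[x, y, z]" "{3, 5}"]
  by (simp add: closed_walk_edges_eq cycle_edges_def triangle_def insert_commute)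

lemma cycle_decomposable_two_triangles:
  assumes "distinct [x, y, x', y', z]"
  shows "cycle_decomposable {3, 5} (triangle x y z \<union> triangle x' y' z)"
  by (intro cycle_decomposable_Un cycle_decomposable_triangle)
    (use assms in \<open>auto simp: triangle_def doubleton_eq_iff\<close>)

text \<open>The closed walks \<open>x y p y' z\<close> and \<open>x' y' q y z\<close> absorb the four-cycle \<open>y p y' q\<close>.\<close>

lemma cycle_decomposable_two_triangles_four_cycle:
  assumes "distinct [x, y, x', y', z, p, q]"
  shows "cycle_decomposable {3, 5} (triangle x y z \<union> triangle x' y' z \<union> bipartite {y, y'} {p, q})"
proof -
  let ?css = "[[x, y, p, y', z], [x', y', q, y, z]]"
  have "distinct (rev [x, y, x', y', z, p, q])"
    using assms by (simp only: distinct_rev)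
  then have "cycle_decomposable {3, 5} (set (concat (map cycle_edges ?css)))"
    by (intro cycle_decomposable_list) (use assms in \<open>simp_all add: cycle_edges_def doubleton_eq_iff\<close>)
  also have "set (concat (map cycle_edges ?css)) =
      triangle x y z \<union> triangle x' y' z \<union> bipartite {y, y'} {p, q}"
    unfolding bipartite_pairs triangle_def
    by (intro equalityI; simp add: cycle_edges_def insert_commute[of p y'] insert_commute[of z x]
        insert_commute[of q y] insert_commute[of z x'])
  finally show ?thesis .
qed

text \<open>The pair \<open>(u, v)\<close> is a subsquare with two places, numbered 0 and 1, and \<open>F\<close> marks the
  subsquares that are not available. Row pair \<open>u\<close> takes place 0 in subsquares out of a cyclic window
  of \<open>p + 3\<close> columns; consecutive rows take consecutive windows, so no column is
  used much more often than the average.\<close>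

lemma exists_balanced_assignment:
  fixes a b p q :: nat and F :: "nat \<Rightarrow> nat \<Rightarrow> bool" and I J :: "nat \<Rightarrow> 'c set"
  assumes rowF: "\<And>u. u < a \<Longrightarrow> card {v. v < b \<and> F u v} \<le> 3"
    and colF: "\<And>v. v < b \<Longrightarrow> card {u. u < a \<and> F u v} \<le> 3"
    and pb: "p + 3 \<le> b" and cap: "a * (p + 3) + b * (q + 7) \<le> 2 * a * b"
    and I: "\<And>u. u < a \<Longrightarrow> finite (I u) \<and> card (I u) = p"
    and J: "\<And>v. v < b \<Longrightarrow> finite (J v) \<and> card (J v) = q"
  shows "\<exists>f g. (\<forall>u<a. inj_on (f u) (I u) \<and> (\<forall>w\<in>I u. f u w < b \<and> \<not> F u (f u w))) \<and>
     (\<forall>v<b. inj_on (g v) (J v) \<and> (\<forall>w\<in>J v. fst (g v w) < a \<and> snd (g v w) < (2::nat) \<and>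
        \<not> F (fst (g v w)) v \<and>
        (snd (g v w) = 0 \<longrightarrow> v \<notin> f (fst (g v w)) ` I (fst (g v w)))))"
proof -
  \<comment> \<open>Three columns to spare, because up to three subsquares of a row are
    forbidden.\<close>
  define P where "P = p + 3"
  define Y where "Y u = (\<lambda>d. (u * P + d) mod b) ` {..<P}" for u
  have b: "0 < b"
    using pb by simp
  have Y: "card (Y u) = P" for u
  proof -
    have "inj_on (\<lambda>d. (u * P + d) mod b) {..<P}"
    proof (rule inj_onI)
      fix d d' assume "d \<in> {..<P}" "d' \<in> {..<P}" "(u * P + d) mod b = (u * P + d') mod b"
      then show "d = d'"
        using pb by (intro add_mod_cancel_less[of d "u * P" b d']) (simp_all add: P_def add.commute)
    qed
    then show ?thesis
      by (simp add: Y_def card_image)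
  qed
  have "\<exists>X f. X \<subseteq> Y u \<and> (\<forall>v\<in>X. v < b \<and> \<not> F u v) \<and> bij_betw f (I u) X" if u: "u < a" for u
  proof -
    have "P - 3 \<le> card (Y u) - card {v. v < b \<and> F u v}"
      using Y rowF[OF u] by simp
    also have "\<dots> \<le> card (Y u - {v. v < b \<and> F u v})"
      by (rule diff_card_le_card_Diff) simp
    finally have "p \<le> card (Y u - {v. v < b \<and> F u v})"
      by (simp add: P_def)
    then obtain X where X: "X \<subseteq> Y u - {v. v < b \<and> F u v}" "card X = p" "finite X"
      by (rule obtain_subset_with_card_n)
    then obtain f where "bij_betw f (I u) X"
      using finite_same_card_bij[of "I u" X] I[OF u] by auto
    moreover have "v < b" if "v \<in> X" for v
      using X(1) that b by (auto simp: Y_def)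
    ultimately show ?thesis
      by (intro exI[of _ X] exI[of _ f] conjI) (use X(1) in auto)
  qed
  then obtain X f where Xf: "\<And>u. u < a \<Longrightarrow> X u \<subseteq> Y u"
    "\<And>u v. u < a \<Longrightarrow> v \<in> X u \<Longrightarrow> v < b \<and> \<not> F u v" "\<And>u. u < a \<Longrightarrow> bij_betw (f u) (I u) (X u)"
    by metis
  \<comment> \<open>The places left for column pair \<open>v\<close>. The whole window
    \<open>Y u\<close> blocks place 0, not just the chosen columns \<open>X u\<close>, because
    windows are easy to count.\<close>
  define G where "G v = ({..<a} \<times> {..<2::nat}) - ({u. u < a \<and> F u v} \<times> {..<2::nat} \<union>
      {u. u < a \<and> v \<in> Y u} \<times> {0})" for v
  have "\<exists>g. inj_on g (J v) \<and> g ` J v \<subseteq> G v" if v: "v < b" for v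
  proof -
    let ?A = "{..<a} \<times> {..<2::nat}"
    let ?B = "{u. u < a \<and> F u v} \<times> {..<2::nat} \<union> {u. u < a \<and> v \<in> Y u} \<times> {0::nat}"
    let ?M = "{m. m < a * P \<and> m mod b = v}"
    \<comment> \<open>Laid end to end, the windows run once through the numbers below
      \<open>a * P\<close>. Column \<open>v\<close> is met only at numbers congruent to
      \<open>v\<close> modulo \<open>b\<close>, hence at most \<open>a * P div b + 1\<close>
      times.\<close>
    have "{u. u < a \<and> v \<in> Y u} \<subseteq> (\<lambda>m. m div P) ` ?M"
    proof
      fix u assume "u \<in> {u. u < a \<and> v \<in> Y u}"
      then obtain d where d: "u < a" "d < P" "v = (u * P + d) mod b"
        by (auto simp: Y_def)
      have "u * P + d < Suc u * P"
        using d by simp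
      also have "\<dots> \<le> a * P"
        using d by (intro mult_right_mono) auto
      finally have "u * P + d \<in> ?M"
        using d by simp
      moreover have "(u * P + d) div P = u"
        using d by simp
      ultimately show "u \<in> (\<lambda>m. m div P) ` ?M"
        by (intro image_eqI[of _ _ "u * P + d"]) (simp_all only: refl)
    qed
    then have "card {u. u < a \<and> v \<in> Y u} \<le> card ?M"
      by (rule surj_card_le[rotated]) simp
    also have "\<dots> \<le> card ((\<lambda>k. k * b + v) ` {..a * P div b})"
    proof (rule card_mono)
      show "?M \<subseteq> (\<lambda>k. k * b + v) ` {..a * P div b}"
      proof
        fix m assume "m \<in> ?M"
        then have "m = m div b * b + v" "m div b \<le> a * P div b"
          using div_mult_mod_eq[of m b] by (auto intro: div_le_mono)
        then show "m \<in> (\<lambda>k. k * b + v) ` {..a * P div b}"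
          by (intro image_eqI[of _ _ "m div b"]) simp_all
      qed
    qed simp
    also have "\<dots> \<le> a * P div b + 1"
      using card_image_le[of "{..a * P div b}"] by simp
    finally have N: "card {u. u < a \<and> v \<in> Y u} \<le> a * P div b + 1" .
    \<comment> \<open>The 7 pays for both places of three forbidden subsquares and for the 1 added
      by rounding.\<close>
    have cap': "a * P + b * (q + 7) \<le> b * (2 * a)"
      using cap by (simp add: P_def algebra_simps)
    then have "b * (q + 7) \<le> b * (2 * a)"
      by linarith
    then have q: "q + 7 \<le> 2 * a"
      using b by simp
    have "a * P \<le> b * (2 * a - (q + 7))"
      using cap' by (simp only: diff_mult_distrib2)
    then have "a * P div b \<le> 2 * a - (q + 7)"
      using b by (metis div_le_mono nonzero_mult_div_cancel_left not_gr_zero)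
    then have "card {u. u < a \<and> v \<in> Y u} \<le> 2 * a - q - 6"
      using N q by simp
    moreover have "card ?B \<le> card {u. u < a \<and> F u v} * 2 + card {u. u < a \<and> v \<in> Y u}"
      by (rule order.trans[OF card_Un_le]) (simp add: card_cartesian_product)
    ultimately have "card ?B \<le> 2 * a - q"
      using colF[OF v] q by simp
    moreover have "card ?A - card ?B \<le> card (?A - ?B)"
      by (rule diff_card_le_card_Diff) simp
    moreover have "card ?A = 2 * a"
      by (simp add: card_cartesian_product)
    ultimately have "card (J v) \<le> card (?A - ?B)"
      using J[OF v] q by linarith
    then have "\<exists>g. g ` J v \<subseteq> G v \<and> inj_on g (J v)"
      unfolding G_def by (intro card_le_inj) (simp_all add: J[OF v])
    then show ?thesis
      by (simp only: conj_commute)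
  qed
  then have "\<forall>v\<in>{..<b}. \<exists>g. inj_on g (J v) \<and> g ` J v \<subseteq> G v"
    by (intro ballI) (simp only: lessThan_iff)
  from bchoice[OF this] obtain g where "\<forall>v\<in>{..<b}. inj_on (g v) (J v) \<and> g v ` J v \<subseteq> G v"
    by (elim exE)
  then have g: "\<And>v. v < b \<Longrightarrow> inj_on (g v) (J v)" "\<And>v. v < b \<Longrightarrow> g v ` J v \<subseteq> G v"
    by (simp_all only: Ball_def lessThan_iff)
  show ?thesis
  proof (intro exI[of _ f] exI[of _ g] conjI allI impI ballI)
    fix u assume u: "u < a"
    show "inj_on (f u) (I u)"
      using Xf(3)[OF u] by (rule bij_betw_imp_inj_on)
    fix w assume "w \<in> I u"
    then have "f u w \<in> X u"
      using Xf(3)[OF u] by (auto simp: bij_betw_def)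
    from Xf(2)[OF u this] show "f u w < b" "\<not> F u (f u w)"
      by simp_all
  next
    fix v assume v: "v < b"
    show "inj_on (g v) (J v)"
      by (rule g(1)[OF v])
    fix w assume "w \<in> J v"
    then have "g v w \<in> G v"
      by (intro subsetD[OF g(2)[OF v] imageI])
    then have *: "fst (g v w) < a \<and> snd (g v w) < 2 \<and> \<not> F (fst (g v w)) v \<and>
        (snd (g v w) = 0 \<longrightarrow> v \<notin> Y (fst (g v w)))"
      by (cases "g v w") (auto simp: G_def)
    then show "fst (g v w) < a" "snd (g v w) < 2" "\<not> F (fst (g v w)) v"
      by simp_all
    assume "snd (g v w) = 0"
    with * have "v \<notin> Y (fst (g v w))"
      by simp
    moreover have "f (fst (g v w)) ` I (fst (g v w)) = X (fst (g v w))"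
      by (rule bij_betw_imp_surj_on[OF Xf(3)]) (use * in simp)
    moreover have "X (fst (g v w)) \<subseteq> Y (fst (g v w))"
      using Xf(1) * by simp
    ultimately show "v \<notin> f (fst (g v w)) ` I (fst (g v w))"
      by blast
  qed
qed

text \<open>\<open>I\<close> indexes the pieces to be absorbed and \<open>U\<close> the possible
  absorbers. Each \<open>i\<close> is decomposed together with its private set
  \<open>\<phi> i\<close>; unclaimed absorbers are decomposed on their own.\<close>

lemma cycle_decomposable_absorb:
  assumes disj: "disjoint_family_on X (U \<union> I)" "U \<inter> I = {}"
    and \<phi>: "\<And>i. i \<in> I \<Longrightarrow> \<phi> i \<subseteq> U" "\<And>i j. i \<in> I \<Longrightarrow> j \<in> I \<Longrightarrow> i \<noteq> j \<Longrightarrow> \<phi> i \<inter> \<phi> j = {}"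
    and U: "\<And>u. u \<in> U \<Longrightarrow> cycle_decomposable N (X u)"
    and I: "\<And>i. i \<in> I \<Longrightarrow> cycle_decomposable N (X i \<union> (\<Union>u\<in>\<phi> i. X u))"
  shows "cycle_decomposable N (\<Union>i\<in>U \<union> I. X i)"
proof -
  have neq: "X i \<inter> X j = {}" if "i \<in> U \<union> I" "j \<in> U \<union> I" "i \<noteq> j" for i j
    using disj(1) that by (rule disjoint_family_onD)
  define U' where "U' = U - (\<Union>i\<in>I. \<phi> i)"
  have "cycle_decomposable N (\<Union>i\<in>I. X i \<union> (\<Union>u\<in>\<phi> i. X u))"
  proof (rule cycle_decomposable_UN[OF _ I])
    show "disjoint_family_on (\<lambda>i. X i \<union> (\<Union>u\<in>\<phi> i. X u)) I"
      unfolding disjoint_family_on_def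
    proof (intro ballI impI equals0I)
      fix i j e
      assume ij: "i \<in> I" "j \<in> I" "i \<noteq> j"
        and e: "e \<in> (X i \<union> (\<Union>u\<in>\<phi> i. X u)) \<inter> (X j \<union> (\<Union>u\<in>\<phi> j. X u))"
      obtain i' where i': "i' \<in> insert i (\<phi> i)" "e \<in> X i'"
        using e by blast
      obtain j' where j': "j' \<in> insert j (\<phi> j)" "e \<in> X j'"
        using e by blast
      have "i' \<in> U \<union> I" "j' \<in> U \<union> I"
        using ij i' j' \<phi>(1) by blast+
      moreover have "i' \<noteq> j'"
        using ij i'(1) j'(1) \<phi>(1)[of i] \<phi>(1)[of j] \<phi>(2)[of i j] disj(2) by blast
      ultimately show False
        using neq i'(2) j'(2) by blast
    qed
  qed
  moreover have "cycle_decomposable N (\<Union>u\<in>U'. X u)"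
    by (rule cycle_decomposable_UN)
      (use disj U in \<open>auto simp: U'_def intro: disjoint_family_on_mono[rotated]\<close>)
  moreover have "(\<Union>i\<in>I. X i \<union> (\<Union>u\<in>\<phi> i. X u)) \<inter> (\<Union>u\<in>U'. X u) = {}"
  proof (rule equals0I)
    fix e assume "e \<in> (\<Union>i\<in>I. X i \<union> (\<Union>u\<in>\<phi> i. X u)) \<inter> (\<Union>u\<in>U'. X u)"
    then obtain i i' u where *: "i \<in> I" "i' \<in> insert i (\<phi> i)" "e \<in> X i'" "u \<in> U'" "e \<in> X u"
      by blast
    then have "i' \<in> U \<union> I" "u \<in> U \<union> I"
      using \<phi>(1) unfolding U'_def by blast+
    moreover have "i' \<noteq> u"
      using * disj(2) unfolding U'_def by blast
    ultimately show False
      using neq *(3,5) by blast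
  qed
  ultimately have "cycle_decomposable N
      ((\<Union>i\<in>I. X i \<union> (\<Union>u\<in>\<phi> i. X u)) \<union> (\<Union>u\<in>U'. X u))"
    by (rule cycle_decomposable_Un)
  moreover have "(\<Union>i\<in>I. X i \<union> (\<Union>u\<in>\<phi> i. X u)) \<union> (\<Union>u\<in>U'. X u) = (\<Union>i\<in>U \<union> I. X i)"
    using \<phi>(1) unfolding U'_def by blast
  ultimately show ?thesis by simp
qed

section \<open>Pairs, super-edges and atoms\<close>

lemma doubleton_edges:
  "{(0, i), (1, j)} = row_col i j" "{(1, j), (0, i)} = row_col i j"
  "{(0, i), (Suc 0, j)} = row_col i j" "{(Suc 0, j), (0, i)} = row_col i j"
  "{(0, i), (2, k)} = row_sym i k" "{(2, k), (0, i)} = row_sym i k"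
  "{(1, j), (2, k)} = col_sym j k" "{(2, k), (1, j)} = col_sym j k"
  "{(Suc 0, j), (2, k)} = col_sym j k" "{(2, k), (Suc 0, j)} = col_sym j k"
  by (auto simp: row_col_def row_sym_def col_sym_def)

abbreviation rv :: "nat \<Rightarrow> nat \<times> nat" where "rv i \<equiv> (0, i)"
abbreviation cv :: "nat \<Rightarrow> nat \<times> nat" where "cv j \<equiv> (1, j)"
abbreviation sv :: "nat \<Rightarrow> nat \<times> nat" where "sv k \<equiv> (2, k)"

text \<open>Rows, columns and symbols \<open>2k\<close> and \<open>2k + 1\<close> form the \<open>k\<close>-th pair. The exceptional row, column
  and symbol of the odd case are the pairs with indices \<open>a\<close>, \<open>b\<close> and \<open>c\<close>, which have one element
  only. A super-edge is the complete bipartite graph between two pairs.\<close>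

datatype super_edge = RC nat nat | RS nat nat | CS nat nat

text \<open>\<open>Unit u v e\<close> is the pair of triangles of subsquare \<open>(u, v)\<close> that share the symbol \<open>e\<close> of its
  pair; \<open>Row\<close>, \<open>Col\<close> and \<open>Rest\<close> are to be absorbed by units; \<open>Corner\<close> is the exceptional
  triangle, and \<open>Diag u\<close> is the rest of the complete tripartite graph on its vertices and on row pair
  \<open>u\<close>, column pair \<open>u\<close> and symbol pair \<open>om u\<close>.\<close>

datatype atom = Unit nat nat nat | Row nat nat | Col nat nat | Diag nat | Corner | Rest nat

text \<open>The enlarged \<open>Col v (om v)\<close> does for \<open>a \<le> v\<close>, where there
  is no diagonal subsquare, what \<open>Diag v\<close> does for \<open>v < a\<close>: it takes the
  edges from \<open>v\<close> to the exceptional row and symbol, and from \<open>om v\<close> to the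
  exceptional row and column.\<close>

primrec atom_super_edges :: "nat \<Rightarrow> nat \<Rightarrow> nat \<Rightarrow> bool \<Rightarrow> (nat \<Rightarrow> nat) \<Rightarrow> (nat \<Rightarrow> nat \<Rightarrow> nat) \<Rightarrow>
    atom \<Rightarrow> super_edge set" where
  "atom_super_edges a b c hole om L (Unit u v e) = {RC u v, RS u (L u v), CS v (L u v)}"
| "atom_super_edges a b c hole om L (Row u w) = {RS u w}"
| "atom_super_edges a b c hole om L (Col v w) =
    (if hole \<and> w = om v then {CS v w, RC a v, RS a w, CS b w, CS v c} else {CS v w})"
| "atom_super_edges a b c hole om L (Diag u) = {RC u u, RS u (om u), CS u (om u), RC u b, RC a u, RS u c, RS a (om u),
    CS u c, CS b (om u)}"
| "atom_super_edges a b c hole om L Corner = {RC a b, RS a c, CS b c}"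
| "atom_super_edges a b c hole om L (Rest w) = {RS a w, CS b w}"

primrec valid_atom :: "nat \<Rightarrow> nat \<Rightarrow> nat \<Rightarrow> bool \<Rightarrow> (nat \<Rightarrow> nat) \<Rightarrow> (nat \<Rightarrow> nat \<Rightarrow> nat) \<Rightarrow>
    atom \<Rightarrow> bool" where
  "valid_atom a b c hole om L (Unit u v e) \<longleftrightarrow> u < a \<and> v < b \<and> e < 2 \<and> (\<not> hole \<or> u \<noteq> v)"
| "valid_atom a b c hole om L (Row u w) \<longleftrightarrow> u < a \<and> w < c \<and> (\<forall>v<b. L u v \<noteq> w)"
| "valid_atom a b c hole om L (Col v w) \<longleftrightarrow> v < b \<and> w < c \<and> (\<forall>u<a. L u v \<noteq> w)"
| "valid_atom a b c hole om L (Diag u) \<longleftrightarrow> hole \<and> u < a"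
| "valid_atom a b c hole om L Corner \<longleftrightarrow> hole"
| "valid_atom a b c hole om L (Rest w) \<longleftrightarrow> hole \<and> w < c \<and> (\<forall>v<b. om v \<noteq> w)"

text \<open>\<open>L\<close> is a Latin rectangle on the pairs. In the odd case (\<open>hole\<close>), \<open>om v\<close> is the symbol pair that
  column pair \<open>v\<close> shares with the exceptional row; for \<open>v < a\<close> it is a diagonal entry. A symbol pair
  \<open>w\<close> outside the range of \<open>om\<close> forms a four-cycle with the exceptional row and column, and this
  is absorbed by the whole subsquare \<open>(qr w, qc w)\<close>, which carries \<open>w\<close>.\<close>

locale block_array =
  fixes a b c :: nat and hole :: bool and L :: "nat \<Rightarrow> nat \<Rightarrow> nat" and om qr qc :: "nat \<Rightarrow> nat"
    and F :: "nat \<Rightarrow> nat \<Rightarrow> bool"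
  assumes ab: "a \<le> b"
    and L_less: "\<And>u v. u < a \<Longrightarrow> v < b \<Longrightarrow> L u v < c"
    and L_row: "\<And>u v v'. u < a \<Longrightarrow> v < b \<Longrightarrow> v' < b \<Longrightarrow> L u v = L u v' \<Longrightarrow> v = v'"
    and L_col: "\<And>u u' v. u < a \<Longrightarrow> u' < a \<Longrightarrow> v < b \<Longrightarrow> L u v = L u' v \<Longrightarrow> u = u'"
    and om_less: "\<And>v. hole \<Longrightarrow> v < b \<Longrightarrow> om v < c"
    and om_inj: "\<And>v v'. hole \<Longrightarrow> v < b \<Longrightarrow> v' < b \<Longrightarrow> om v = om v' \<Longrightarrow> v = v'"
    and om_diag: "\<And>u. hole \<Longrightarrow> u < a \<Longrightarrow> L u u = om u"
    and om_col: "\<And>u v. hole \<Longrightarrow> v < b \<Longrightarrow> a \<le> v \<Longrightarrow> u < a \<Longrightarrow> L u v \<noteq> om v"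
    and rest: "\<And>w. hole \<Longrightarrow> w < c \<Longrightarrow> \<forall>v<b. om v \<noteq> w \<Longrightarrow>
      qr w < a \<and> qc w < b \<and> L (qr w) (qc w) = w \<and> F (qr w) (qc w)"
    and F_diag: "\<And>u. hole \<Longrightarrow> F u u"
    and F_row: "\<And>u. u < a \<Longrightarrow> card {v. v < b \<and> F u v} \<le> 3"
    and F_col: "\<And>v. v < b \<Longrightarrow> card {u. u < a \<and> F u v} \<le> 3"
    and bc: "b \<le> c" and cb: "c + 3 \<le> 2 * b"
    and capacity: "a * (c - b + 3) + b * (c - a + 7) \<le> 2 * a * b"
begin

definition fibre :: "nat \<Rightarrow> nat \<Rightarrow> nat set" where
  "fibre n k = (if k < n then {2 * k, 2 * k + 1} else {2 * k})"

primrec super :: "super_edge \<Rightarrow> (nat \<times> nat) set set" where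
  "super (RC u v) = case_prod row_col ` (fibre a u \<times> fibre b v)"
| "super (RS u w) = case_prod row_sym ` (fibre a u \<times> fibre c w)"
| "super (CS v w) = case_prod col_sym ` (fibre b v \<times> fibre c w)"

abbreviation super_edges :: "atom \<Rightarrow> super_edge set" where
  "super_edges \<equiv> atom_super_edges a b c hole om L"

abbreviation valid :: "atom \<Rightarrow> bool" where
  "valid \<equiv> valid_atom a b c hole om L"

text \<open>A subsquare is the addition table modulo 2: row \<open>2 * u + x\<close> and column
  \<open>2 * v + y\<close> carry the symbol of pair \<open>w\<close> whose parity is that of
  \<open>x + y\<close>. The unit consists of the two cells where this parity is
  \<open>e\<close>.\<close>

definition unit :: "nat \<Rightarrow> nat \<Rightarrow> nat \<Rightarrow> (nat \<times> nat) set set" where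
  "unit u v e = (let w = L u v in
    triangle (1, 2 * v + e) (0, 2 * u) (2, 2 * w + e) \<union>
    triangle (1, 2 * v + 1 - e) (0, 2 * u + 1) (2, 2 * w + e))"

definition piece :: "atom \<Rightarrow> (nat \<times> nat) set set" where
  "piece \<alpha> = (case \<alpha> of Unit u v e \<Rightarrow> unit u v e | _ \<Rightarrow> \<Union>(super ` super_edges \<alpha>))"

text \<open>For \<open>v < a\<close>, the pair \<open>om v\<close> is the entry of the diagonal
  subsquare \<open>(v, v)\<close>, so column pair \<open>v\<close> does not miss it.\<close>

lemma Col_om_ge: "\<forall>u<a. L u v \<noteq> om v \<Longrightarrow> hole \<Longrightarrow> a \<le> v"
  using om_diag[of v] by (meson not_less)

section \<open>The atoms split the edge set\<close>

lemma RC_cases: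
  assumes "valid \<alpha>" "RC x y \<in> super_edges \<alpha>"
  shows "(\<exists>e. \<alpha> = Unit x y e) \<and> x < a \<and> y < b \<and> (\<not> hole \<or> x \<noteq> y) \<or>
    \<alpha> = Diag x \<and> hole \<and> x < a \<and> (y = x \<or> y = b) \<or> \<alpha> = Diag y \<and> hole \<and> x = a \<and> y < a \<or>
    \<alpha> = Col y (om y) \<and> hole \<and> x = a \<and> a \<le> y \<and> y < b \<or> \<alpha> = Corner \<and> x = a \<and> y = b"
  using assms Col_om_ge by (cases \<alpha>) (auto split: if_splits)

lemma RS_cases:
  assumes "valid \<alpha>" "RS x y \<in> super_edges \<alpha>"
  shows "(\<exists>v e. \<alpha> = Unit x v e \<and> x < a \<and> v < b \<and> (\<not> hole \<or> x \<noteq> v) \<and> y = L x v \<and> y < c) \<or>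
    \<alpha> = Row x y \<and> x < a \<and> y < c \<and> (\<forall>v<b. L x v \<noteq> y) \<or>
    \<alpha> = Diag x \<and> hole \<and> x < a \<and> (y = L x x \<and> y < c \<or> y = c) \<or>
    (\<exists>v. \<alpha> = Diag v \<and> hole \<and> x = a \<and> v < a \<and> y = om v \<and> y < c) \<or>
    (\<exists>v. \<alpha> = Col v y \<and> hole \<and> x = a \<and> a \<le> v \<and> v < b \<and> y = om v \<and> y < c) \<or>
    \<alpha> = Rest y \<and> hole \<and> x = a \<and> y < c \<and> (\<forall>v<b. om v \<noteq> y) \<or> \<alpha> = Corner \<and> x = a \<and> y = c"
  using assms Col_om_ge om_diag om_less L_less ab by (cases \<alpha>) (auto split: if_splits)

lemma CS_cases:
  assumes "valid \<alpha>" "CS x y \<in> super_edges \<alpha>"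
  shows "(\<exists>u e. \<alpha> = Unit u x e \<and> u < a \<and> x < b \<and> (\<not> hole \<or> u \<noteq> x) \<and> y = L u x \<and> y < c) \<or>
    \<alpha> = Col x y \<and> x < b \<and> y < c \<and> (\<forall>u<a. L u x \<noteq> y) \<or>
    \<alpha> = Col x (om x) \<and> hole \<and> a \<le> x \<and> x < b \<and> y = c \<or>
    \<alpha> = Diag x \<and> hole \<and> x < a \<and> (y = L x x \<and> y < c \<or> y = c) \<or>
    (\<exists>v. \<alpha> = Diag v \<and> hole \<and> x = b \<and> v < a \<and> y = om v \<and> y < c) \<or>
    (\<exists>v. \<alpha> = Col v y \<and> hole \<and> x = b \<and> a \<le> v \<and> v < b \<and> y = om v \<and> y < c) \<or>
    \<alpha> = Rest y \<and> hole \<and> x = b \<and> y < c \<and> (\<forall>v<b. om v \<noteq> y) \<or> \<alpha> = Corner \<and> x = b \<and> y = c"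
  using assms Col_om_ge om_diag om_less L_less ab by (cases \<alpha>) (auto split: if_splits)

text \<open>The two units of a subsquare share its three super-edges, so a super-edge can determine
  an atom only up to the place \<open>e\<close>.\<close>

definition key :: "atom \<Rightarrow> atom" where
  "key \<alpha> = (case \<alpha> of Unit u v e \<Rightarrow> Unit u v 0 | _ \<Rightarrow> \<alpha>)"

lemma key_simps [simp]:
  "key (Unit u v e) = Unit u v 0" "key (Row u w) = Row u w" "key (Col v w) = Col v w"
  "key (Diag u) = Diag u" "key Corner = Corner" "key (Rest w) = Rest w"
  by (simp_all add: key_def)

text \<open>The owner of a super-edge can be read off from its indices, so valid atoms with a common
  super-edge have the same key.\<close>

lemma RC_key: "\<exists>\<kappa>. \<forall>\<alpha>. valid \<alpha> \<longrightarrow> RC x y \<in> super_edges \<alpha> \<longrightarrow> key \<alpha> = \<kappa>"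
proof -
  let ?\<kappa> = "if x < a then if y < b \<and> (\<not> hole \<or> x \<noteq> y) then Unit x y 0 else Diag x
    else if y < a then Diag y else if y < b then Col y (om y) else Corner"
  have "key \<alpha> = ?\<kappa>" if "valid \<alpha>" "RC x y \<in> super_edges \<alpha>" for \<alpha>
    using RC_cases[OF that] ab by (elim disjE exE conjE) simp_all
  then show ?thesis by blast
qed

lemma RS_key: "\<exists>\<kappa>. \<forall>\<alpha>. valid \<alpha> \<longrightarrow> RS x y \<in> super_edges \<alpha> \<longrightarrow> key \<alpha> = \<kappa>"
proof -
  \<comment> \<open>\<open>L_row\<close> and \<open>om_inj\<close> make these column pairs unique;
    the descriptions are consulted only where such a pair exists.\<close>
  define v where "v = (THE v. v < b \<and> L x v = y)"
  define v' where "v' = (THE v. v < b \<and> om v = y)"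
  have v: "v = u" if "x < a" "u < b" "y = L x u" for u
    unfolding v_def by (rule the_equality) (use that L_row in auto)
  have v': "v' = u" if hole "u < b" "y = om u" for u
    unfolding v'_def by (rule the_equality) (use that om_inj in auto)
  let ?\<kappa> = "if x < a then
      if y < c then
        if \<exists>u<b. y = L x u then if hole \<and> x = v then Diag x else Unit x v 0 else Row x y
      else Diag x
    else if y < c then
        if \<exists>u<b. y = om u then if v' < a then Diag v' else Col v' y else Rest y
      else Corner"
  have "key \<alpha> = ?\<kappa>" if "valid \<alpha>" "RS x y \<in> super_edges \<alpha>" for \<alpha>
    using RS_cases[OF that]
  proof (elim disjE exE conjE)
    fix u e assume "\<alpha> = Unit x u e" "x < a" "u < b" "\<not> hole" "y = L x u" "y < c"
    then show ?thesis using v[of u] by auto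
  next
    fix u e assume "\<alpha> = Unit x u e" "x < a" "u < b" "x \<noteq> u" "y = L x u" "y < c"
    then show ?thesis using v[of u] by auto
  next
    assume "\<alpha> = Row x y" "x < a" "y < c" "\<forall>v<b. L x v \<noteq> y"
    then show ?thesis by auto
  next
    assume "\<alpha> = Diag x" hole "x < a" "y = L x x" "y < c"
    moreover from this have "\<exists>u<b. y = L x u"
      using ab by (intro exI[of _ x]) simp
    ultimately show ?thesis using v[of x] ab by simp
  next
    fix u assume "\<alpha> = Diag u" hole "x = a" "u < a" "y = om u" "y < c"
    moreover from this have "\<exists>u<b. y = om u"
      using ab by (intro exI[of _ u]) simp
    ultimately show ?thesis using v'[of u] ab by simp
  next
    fix u assume "\<alpha> = Col u y" hole "x = a" "a \<le> u" "u < b" "y = om u" "y < c"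
    then show ?thesis using v'[of u] ab by auto
  next
    assume "\<alpha> = Rest y" "x = a" "y < c" "\<forall>v<b. om v \<noteq> y"
    then show ?thesis by auto
  qed simp_all
  then show ?thesis by blast
qed

lemma CS_key: "\<exists>\<kappa>. \<forall>\<alpha>. valid \<alpha> \<longrightarrow> CS x y \<in> super_edges \<alpha> \<longrightarrow> key \<alpha> = \<kappa>"
proof -
  define v where "v = (THE v. v < a \<and> L v x = y)"
  define v' where "v' = (THE v. v < b \<and> om v = y)"
  have v: "v = u" if "x < b" "u < a" "y = L u x" for u
    unfolding v_def by (rule the_equality) (use that L_col in auto)
  have v': "v' = u" if hole "u < b" "y = om u" for u
    unfolding v'_def by (rule the_equality) (use that om_inj in auto)
  let ?\<kappa> = "if x < b then
      if y < c then
        if \<exists>u<a. y = L u x then if hole \<and> x = v then Diag x else Unit v x 0 else Col x y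
      else if x < a then Diag x else Col x (om x)
    else if y < c then
        if \<exists>u<b. y = om u then if v' < a then Diag v' else Col v' y else Rest y
      else Corner"
  have "key \<alpha> = ?\<kappa>" if "valid \<alpha>" "CS x y \<in> super_edges \<alpha>" for \<alpha>
    using CS_cases[OF that]
  proof (elim disjE exE conjE)
    fix u e assume "\<alpha> = Unit u x e" "u < a" "x < b" "\<not> hole" "y = L u x" "y < c"
    then show ?thesis using v[of u] by auto
  next
    fix u e assume "\<alpha> = Unit u x e" "u < a" "x < b" "u \<noteq> x" "y = L u x" "y < c"
    then show ?thesis using v[of u] by auto
  next
    assume "\<alpha> = Col x y" "x < b" "y < c" "\<forall>u<a. L u x \<noteq> y"
    then show ?thesis by auto
  next
    assume "\<alpha> = Diag x" hole "x < a" "y = L x x" "y < c"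
    moreover from this have "\<exists>u<a. y = L u x"
      by (intro exI[of _ x]) simp
    ultimately show ?thesis using v[of x] ab by simp
  next
    assume "\<alpha> = Diag x" hole "x < a" "y = c"
    then show ?thesis using ab by auto
  next
    fix u assume "\<alpha> = Diag u" hole "x = b" "u < a" "y = om u" "y < c"
    moreover from this have "\<exists>u<b. y = om u"
      using ab by (intro exI[of _ u]) simp
    ultimately show ?thesis using v'[of u] ab by simp
  next
    fix u assume "\<alpha> = Col u y" hole "x = b" "a \<le> u" "u < b" "y = om u" "y < c"
    then show ?thesis using v'[of u] ab by auto
  next
    assume "\<alpha> = Rest y" "x = b" "y < c" "\<forall>v<b. om v \<noteq> y"
    then show ?thesis by auto
  qed simp_all
  then show ?thesis by blast
qed

lemma super_edges_key:
  assumes "valid \<alpha>" "valid \<beta>" "\<sigma> \<in> super_edges \<alpha>" "\<sigma> \<in> super_edges \<beta>"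
  shows "key \<alpha> = key \<beta>"
  using assms RC_key RS_key CS_key by (cases \<sigma>) metis+

lemma super_disjoint: "e \<in> super \<sigma> \<Longrightarrow> e \<in> super \<tau> \<Longrightarrow> \<sigma> = \<tau>"
  by (cases \<sigma>; cases \<tau>; force simp: fibre_def split: if_splits)

text \<open>In a 2 x 2 Latin square every row-column, row-symbol and column-symbol combination
  occurs in exactly one cell, so the four triangles fill three copies of K_{2,2}.\<close>

lemma super_Unit:
  assumes "valid (Unit u v e)"
  shows "unit u v 0 \<union> unit u v 1 = \<Union>(super ` super_edges (Unit u v e))"
  using assms L_less[of u v]
  by (auto simp: unit_def Let_def triangle_def doubleton_edges fibre_def)

lemma unit_subset: "valid (Unit u v e) \<Longrightarrow> unit u v e \<subseteq> \<Union>(super ` super_edges (Unit u v e))"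
  using super_Unit[of u v e] by (auto simp: less_2_cases_iff)

lemma unit_disjoint: "unit u v 0 \<inter> unit u v 1 = {}"
  by (auto simp: unit_def Let_def triangle_def doubleton_edges)

lemma piece_simps:
  "piece (Unit u v e) = unit u v e"
  "piece (Row u w) = \<Union>(super ` super_edges (Row u w))"
  "piece (Col v w) = \<Union>(super ` super_edges (Col v w))"
  "piece (Diag u) = \<Union>(super ` super_edges (Diag u))"
  "piece Corner = \<Union>(super ` super_edges Corner)"
  "piece (Rest w) = \<Union>(super ` super_edges (Rest w))"
  unfolding piece_def by (simp_all only: atom.case)

lemma piece_subset: "valid \<alpha> \<Longrightarrow> piece \<alpha> \<subseteq> \<Union>(super ` super_edges \<alpha>)"
  by (cases \<alpha>) (simp_all only: piece_simps unit_subset order.refl)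

lemma piece_disjoint:
  assumes "valid \<alpha>" "valid \<beta>" "e \<in> piece \<alpha>" "e \<in> piece \<beta>"
  shows "\<alpha> = \<beta>"
proof -
  obtain \<sigma> \<tau> where "\<sigma> \<in> super_edges \<alpha>" "e \<in> super \<sigma>" "\<tau> \<in> super_edges \<beta>" "e \<in> super \<tau>"
    using assms piece_subset by blast
  then have "key \<alpha> = key \<beta>"
    using super_edges_key[OF assms(1,2)] super_disjoint by metis
  then consider "\<alpha> = \<beta>" | u v x y where "\<alpha> = Unit u v x" "\<beta> = Unit u v y"
    by (cases \<alpha>; cases \<beta>) simp_all
  then show ?thesis
  proof cases
    case 2
    then have "x < 2" "y < 2" "e \<in> unit u v x" "e \<in> unit u v y"
      using assms by (auto simp: piece_def)
    then show ?thesis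
      using 2 unit_disjoint[of u v] by (auto simp: less_2_cases_iff)
  qed
qed

lemma super_edges_subset:
  assumes "valid \<alpha>"
  shows "\<Union>(super ` super_edges \<alpha>) \<subseteq> \<Union>(piece ` {\<alpha>. valid \<alpha>})"
proof (cases "\<exists>u v e. \<alpha> = Unit u v e")
  case True
  then obtain u v e where \<alpha>: "\<alpha> = Unit u v e"
    by blast
  then have "valid (Unit u v 0)" "valid (Unit u v 1)"
    using assms by auto
  then have "piece (Unit u v 0) \<union> piece (Unit u v 1) \<subseteq> \<Union>(piece ` {\<alpha>. valid \<alpha>})"
    by blast
  then show ?thesis
    using super_Unit[OF assms[unfolded \<alpha>]] unfolding \<alpha> by (simp only: piece_simps)
next
  case False
  then have "piece \<alpha> = \<Union>(super ` super_edges \<alpha>)"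
    by (cases \<alpha>) (simp_all only: piece_simps atom.inject, blast)
  then show ?thesis
    using assms by blast
qed

lemma mem_fibre:
  assumes "i < 2 * n + of_bool hole"
  shows "i \<in> fibre n (i div 2)" "i div 2 < n \<or> hole \<and> i div 2 = n"
proof -
  show "i div 2 < n \<or> hole \<and> i div 2 = n"
    using assms by (cases hole) auto
  show "i \<in> fibre n (i div 2)"
    using assms by (cases hole) (auto simp: fibre_def)
qed

lemma fibre_less:
  assumes "k < n \<or> hole \<and> k = n" "i \<in> fibre n k"
  shows "i < 2 * n + of_bool hole"
  using assms by (auto simp: fibre_def split: if_splits)

lemma exists_atom_RC:
  assumes "u < a \<or> hole \<and> u = a" "v < b \<or> hole \<and> v = b"
  shows "\<exists>\<alpha>. valid \<alpha> \<and> RC u v \<in> super_edges \<alpha>"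
proof -
  consider "u < a" "v < b" "\<not> hole \<or> u \<noteq> v" | "u < a" hole "u = v \<or> v = b" | "v < a" hole "u = a"
    | "a \<le> v" "v < b" hole "u = a" | hole "u = a" "v = b"
    using assms by linarith
  then show ?thesis
  proof cases
    case 1
    then show ?thesis by (intro exI[of _ "Unit u v 0"]) simp
  next
    case 2
    then show ?thesis by (intro exI[of _ "Diag u"]) auto
  next
    case 3
    then show ?thesis by (intro exI[of _ "Diag v"]) simp
  next
    case 4
    then show ?thesis using om_less om_col by (intro exI[of _ "Col v (om v)"]) simp
  next
    case 5
    then show ?thesis by (intro exI[of _ Corner]) simp
  qed
qed

text \<open>The edges from \<open>w\<close> to the exceptional row and to the exceptional column
  stay together. Their atom depends on whether \<open>w\<close> is \<open>om v\<close> with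
  \<open>v < a\<close>, \<open>om v\<close> with \<open>a \<le> v\<close>, or no value of
  \<open>om\<close>.\<close>

lemma exists_atom_hole:
  assumes hole "w < c"
  shows "\<exists>\<alpha>. valid \<alpha> \<and> RS a w \<in> super_edges \<alpha> \<and> CS b w \<in> super_edges \<alpha>"
proof -
  consider v where "v < a" "om v = w" | v where "a \<le> v" "v < b" "om v = w" | "\<forall>v<b. om v \<noteq> w"
    by (meson not_less)
  then show ?thesis
  proof cases
    case (1 v)
    then show ?thesis using assms by (intro exI[of _ "Diag v"]) simp
  next
    case (2 v)
    then show ?thesis using assms om_col by (intro exI[of _ "Col v w"]) auto
  next
    case 3
    then show ?thesis using assms by (intro exI[of _ "Rest w"]) simp
  qed
qed

lemma exists_atom_RS:
  assumes "u < a \<or> hole \<and> u = a" "w < c \<or> hole \<and> w = c"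
  shows "\<exists>\<alpha>. valid \<alpha> \<and> RS u w \<in> super_edges \<alpha>"
proof -
  consider v where "u < a" "w < c" "v < b" "L u v = w" "\<not> hole \<or> u \<noteq> v"
    | "u < a" hole "L u u = w \<or> w = c" | "u < a" "w < c" "\<forall>v<b. L u v \<noteq> w"
    | "w < c" hole "u = a" | hole "u = a" "w = c"
    using assms by blast
  then show ?thesis
  proof cases
    case (1 v)
    then show ?thesis by (intro exI[of _ "Unit u v 0"]) simp
  next
    case 2
    then show ?thesis using om_diag by (intro exI[of _ "Diag u"]) auto
  next
    case 3
    then show ?thesis by (intro exI[of _ "Row u w"]) simp
  next
    case 4
    then show ?thesis using exists_atom_hole by blast
  next
    case 5
    then show ?thesis by (intro exI[of _ Corner]) simp
  qed
qed

lemma exists_atom_CS: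
  assumes "v < b \<or> hole \<and> v = b" "w < c \<or> hole \<and> w = c"
  shows "\<exists>\<alpha>. valid \<alpha> \<and> CS v w \<in> super_edges \<alpha>"
proof -
  consider u where "v < b" "w < c" "u < a" "L u v = w" "\<not> hole \<or> u \<noteq> v"
    | "v < a" hole "L v v = w \<or> w = c" | "v < b" "w < c" "\<forall>u<a. L u v \<noteq> w"
    | "a \<le> v" "v < b" hole "w = c"
    | "w < c" hole "v = b" | hole "v = b" "w = c"
    using assms linorder_not_less[of v a] by blast
  then show ?thesis
  proof cases
    case (1 u)
    then show ?thesis by (intro exI[of _ "Unit u v 0"]) simp
  next
    case 2
    then show ?thesis using om_diag by (intro exI[of _ "Diag v"]) auto
  next
    case 3
    then show ?thesis by (intro exI[of _ "Col v w"]) simp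
  next
    case 4
    then show ?thesis using om_less om_col by (intro exI[of _ "Col v (om v)"]) simp
  next
    case 5
    then show ?thesis using exists_atom_hole by blast
  next
    case 6
    then show ?thesis by (intro exI[of _ Corner]) simp
  qed
qed

text \<open>With \<open>piece_disjoint\<close>, this writes the graph as a disjoint union of pieces.
  The summand \<open>of_bool hole\<close> is the exceptional vertex of each part, so both parities
  are covered.\<close>

lemma edges_eq_Union_piece:
  "edges (complete_tripartite (2 * a + of_bool hole) (2 * b + of_bool hole) (2 * c + of_bool hole)) =
    \<Union>(piece ` {\<alpha>. valid \<alpha>})" (is "?E = ?P")
proof
  have sub: "super \<sigma> \<subseteq> ?P" if "\<exists>\<alpha>. valid \<alpha> \<and> \<sigma> \<in> super_edges \<alpha>" for \<sigma>
    using that super_edges_subset by blast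
  have "row_col i j \<in> ?P" if "i < 2 * a + of_bool hole" "j < 2 * b + of_bool hole" for i j
    by (rule subsetD[OF sub[OF exists_atom_RC[OF mem_fibre(2)[OF that(1)] mem_fibre(2)[OF that(2)]]]])
      (simp add: mem_fibre(1)[OF that(1)] mem_fibre(1)[OF that(2)] pair_imageI)
  moreover have "row_sym i j \<in> ?P" if "i < 2 * a + of_bool hole" "j < 2 * c + of_bool hole" for i j
    by (rule subsetD[OF sub[OF exists_atom_RS[OF mem_fibre(2)[OF that(1)] mem_fibre(2)[OF that(2)]]]])
      (simp add: mem_fibre(1)[OF that(1)] mem_fibre(1)[OF that(2)] pair_imageI)
  moreover have "col_sym i j \<in> ?P" if "i < 2 * b + of_bool hole" "j < 2 * c + of_bool hole" for i j
    by (rule subsetD[OF sub[OF exists_atom_CS[OF mem_fibre(2)[OF that(1)] mem_fibre(2)[OF that(2)]]]])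
      (simp add: mem_fibre(1)[OF that(1)] mem_fibre(1)[OF that(2)] pair_imageI)
  ultimately show "?E \<subseteq> ?P"
    unfolding edges_complete_tripartite by auto
  have super: "super \<sigma> \<subseteq> ?E" if "valid \<alpha>" "\<sigma> \<in> super_edges \<alpha>" for \<sigma> \<alpha>
  proof (cases \<sigma>)
    case (RC u v)
    have *: "u < a \<or> hole \<and> u = a" "v < b \<or> hole \<and> v = b"
      using RC_cases[OF that(1) that(2)[unfolded RC]] that(1) ab by auto
    show ?thesis
      unfolding RC edges_complete_tripartite using fibre_less[OF *(1)] fibre_less[OF *(2)] by auto
  next
    case (RS u w)
    have *: "u < a \<or> hole \<and> u = a" "w < c \<or> hole \<and> w = c"
      using RS_cases[OF that(1) that(2)[unfolded RS]] that(1) by auto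
    show ?thesis
      unfolding RS edges_complete_tripartite using fibre_less[OF *(1)] fibre_less[OF *(2)] by auto
  next
    case (CS v w)
    have *: "v < b \<or> hole \<and> v = b" "w < c \<or> hole \<and> w = c"
      using CS_cases[OF that(1) that(2)[unfolded CS]] that(1) ab by auto
    show ?thesis
      unfolding CS edges_complete_tripartite using fibre_less[OF *(1)] fibre_less[OF *(2)] by auto
  qed
  have "piece \<alpha> \<subseteq> ?E" if "valid \<alpha>" for \<alpha>
    using piece_subset[OF that] super[OF that] by blast
  then show "?P \<subseteq> ?E"
    by blast
qed

section \<open>Decomposing each atom, alone or with its absorbers\<close>

lemma cycle_decomposable_unit:
  assumes "e < 2"
  shows "cycle_decomposable {3, 5} (unit u v e)"
  unfolding unit_def Let_def
  by (rule cycle_decomposable_two_triangles) (use assms in \<open>auto simp: less_2_cases_iff\<close>)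

lemma cycle_decomposable_Corner: "cycle_decomposable {3, 5} (piece Corner)"
proof -
  have "piece Corner = triangle (rv (2 * a)) (cv (2 * b)) (sv (2 * c))"
    unfolding piece_simps by (simp add: fibre_def triangle_def doubleton_edges) blast
  then show ?thesis
    by (simp add: cycle_decomposable_triangle)
qed

text \<open>The triangles of the idempotent Latin square of order 3, without its last diagonal cell.\<close>

lemma cycle_decomposable_Diag:
  assumes "valid (Diag u)"
  shows "cycle_decomposable {3, 5} (piece (Diag u))"
proof -
  have u: "u < a" "u < b" "om u < c"
    using assms ab om_less[of u] by auto
  let ?w = "om u"
  let ?css = "[[(rv (2 * u)), (cv (2 * u)), (sv (2 * ?w))], [(rv (2 * u + 1)), (cv (2 * u + 1)), (sv (2 * ?w + 1))],
     [(rv (2 * u)), (cv (2 * u + 1)), (sv (2 * c))], [(rv (2 * u + 1)), (cv (2 * u)), (sv (2 * c))],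
     [(rv (2 * u)), (cv (2 * b)), (sv (2 * ?w + 1))], [(rv (2 * a)), (cv (2 * u)), (sv (2 * ?w + 1))],
     [(rv (2 * u + 1)), (cv (2 * b)), (sv (2 * ?w))], [(rv (2 * a)), (cv (2 * u + 1)), (sv (2 * ?w))]]
     :: (nat \<times> nat) list list"
  have "cycle_decomposable {3, 5} (set (concat (map cycle_edges ?css)))"
    by (rule cycle_decomposable_list, insert u, simp add: cycle_edges_def doubleton_edges, simp)
  also have "set (concat (map cycle_edges ?css)) = piece (Diag u)"
    unfolding piece_simps
    by (intro equalityI; use u in \<open>simp add: cycle_edges_def doubleton_edges fibre_def\<close>)
  finally show ?thesis .
qed

text \<open>The triangles of the unit contain different rows of pair \<open>u\<close> and share a
  symbol outside pair \<open>w\<close>, so they can absorb the four-cycle between these rows and the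
  symbols of \<open>w\<close>.\<close>

lemma cycle_decomposable_Row:
  assumes "valid (Row u w)" "valid (Unit u v e)"
  shows "cycle_decomposable {3, 5} (piece (Row u w) \<union> piece (Unit u v e))"
proof -
  have *: "L u v \<noteq> w" "u < a" "w < c" "e = 0 \<or> e = 1"
    using assms by auto
  have "piece (Row u w) = bipartite {(rv (2 * u)), (rv (2 * u + 1))} {(sv (2 * w)), (sv (2 * w + 1))}"
    unfolding piece_simps using * by (auto simp: fibre_def bipartite_pairs doubleton_edges)
  moreover have "2 * L u v + e \<noteq> 2 * w" "2 * L u v + e \<noteq> 2 * w + 1"
    using *(1,4) by presburger+
  ultimately show ?thesis
    using cycle_decomposable_two_triangles_four_cycle[of "(cv (2 * v + e))" "(rv (2 * u))"
        "(cv (2 * v + 1 - e))" "(rv (2 * u + 1))" "(sv (2 * L u v + e))" "(sv (2 * w))" "(sv (2 * w + 1))"] *(4)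
    by (auto simp: piece_simps(1) unit_def Let_def Un_ac)
qed

text \<open>Rows and columns exchange roles. The symbols \<open>p\<close> and \<open>q\<close> need
  not form a pair, since an enlarged \<open>Col\<close> atom leaves a four-cycle through the
  exceptional symbol.\<close>

lemma cycle_decomposable_unit_column:
  assumes e: "e < 2" and pq: "p \<noteq> q" "p \<noteq> 2 * L u v + e" "q \<noteq> 2 * L u v + e"
  shows "cycle_decomposable {3, 5} (bipartite {(cv (2 * v)), (cv (2 * v + 1))} {(sv (p)), (sv (q))} \<union> unit u v e)"
proof -
  have "bipartite {(cv (2 * v)), (cv (2 * v + 1))} {(sv (p)), (sv (q))} =
      bipartite {(cv (2 * v + e)), (cv (2 * v + 1 - e))} {(sv (p)), (sv (q))}"
    using e by (auto simp: less_2_cases_iff insert_commute)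
  moreover have "triangle x y z = triangle y x z" for x y z :: "nat \<times> nat"
    by (auto simp: triangle_def)
  ultimately show ?thesis
    using cycle_decomposable_two_triangles_four_cycle[of "(rv (2 * u))" "(cv (2 * v + e))"
        "(rv (2 * u + 1))" "(cv (2 * v + 1 - e))" "(sv (2 * L u v + e))" "(sv (p))" "(sv (q))"] e pq
    by (auto simp: unit_def Let_def Un_ac less_2_cases_iff)
qed

lemma cycle_decomposable_Col:
  assumes "valid (Col v w)" "valid (Unit u v e)"
  shows "cycle_decomposable {3, 5} (piece (Col v w) \<union> piece (Unit u v e))"
proof -
  have *: "L u v \<noteq> w" "u < a" "v < b" "w < c" "e < 2" "L u v < c"
    using assms L_less[of u v] by auto
  then have neq: "2 * w \<noteq> 2 * L u v + e" "2 * w + 1 \<noteq> 2 * L u v + e" "2 * c \<noteq> 2 * L u v + e"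
    by presburger+
  show ?thesis
  proof (cases "hole \<and> w = om v")
    case False
    then have "piece (Col v w) = bipartite {(cv (2 * v)), (cv (2 * v + 1))} {(sv (2 * w)), (sv (2 * w + 1))}"
      unfolding piece_simps using * by (auto simp: fibre_def bipartite_pairs doubleton_edges)
    then show ?thesis
      using cycle_decomposable_unit_column[of e "2 * w" "2 * w + 1"] * neq by (simp add: piece_simps(1))
  next
    case True
    \<comment> \<open>The twelve edges split into a 5-cycle, a triangle and the four-cycle
      \<open>?Y\<close>; only \<open>?Y\<close> has to be absorbed.\<close>
    let ?css = "[[(cv (2 * b)), (sv (2 * w)), (cv (2 * v)), (rv (2 * a)), (sv (2 * w + 1))],
        [(rv (2 * a)), (cv (2 * v + 1)), (sv (2 * w))]] :: (nat \<times> nat) list list"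
    let ?X = "set (concat (map cycle_edges ?css))"
    let ?Y = "bipartite {(cv (2 * v)), (cv (2 * v + 1))} {(sv (2 * w + 1)), (sv (2 * c))}"
    have X: "cycle_decomposable {3, 5} ?X"
      by (rule cycle_decomposable_list, insert *, simp add: cycle_edges_def doubleton_edges, simp)
    have piece: "piece (Col v w) = ?X \<union> ?Y"
      unfolding piece_simps
      by (intro equalityI; use * True in \<open>simp add: cycle_edges_def bipartite_pairs doubleton_edges fibre_def\<close>)
    have "?X \<inter> ?Y = {}"
      using * by (simp add: cycle_edges_def bipartite_pairs doubleton_edges)
    moreover have "?X \<inter> unit u v e = {}"
      using piece_disjoint[OF assms] piece by (auto simp: piece_simps(1))
    ultimately have "cycle_decomposable {3, 5} (?X \<union> (?Y \<union> unit u v e))"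
      using cycle_decomposable_unit_column[of e "2 * w + 1" "2 * c"] * neq
      by (intro cycle_decomposable_Un[OF X]) auto
    then show ?thesis
      by (simp only: piece piece_simps(1) Un_assoc)
  qed
qed

text \<open>This four-cycle passes through both symbols of pair \<open>w\<close>, so it is absorbed
  by two triangles that share a row and differ in the symbol. They come from different units, hence
  the whole subsquare is regrouped by rows.\<close>

lemma cycle_decomposable_Rest:
  assumes "valid (Rest w)" "valid (Unit u v e)" "L u v = w"
  shows "cycle_decomposable {3, 5} (piece (Rest w) \<union> (piece (Unit u v 0) \<union> piece (Unit u v 1)))"
proof -
  have *: "u < a" "v < b" "w < c" "u \<noteq> v"
    using assms by auto
  let ?R = "triangle (cv (2 * v + 1)) (sv (2 * w)) (rv (2 * u + 1)) \<union>
    triangle (cv (2 * v)) (sv (2 * w + 1)) (rv (2 * u + 1))"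
  let ?Q = "triangle (cv (2 * v)) (sv (2 * w)) (rv (2 * u)) \<union> triangle (cv (2 * v + 1)) (sv (2 * w + 1)) (rv (2 * u))
    \<union> bipartite {(sv (2 * w)), (sv (2 * w + 1))} {(rv (2 * a)), (cv (2 * b))}"
  have "cycle_decomposable {3, 5} ?R"
    by (rule cycle_decomposable_two_triangles) simp
  moreover have "cycle_decomposable {3, 5} ?Q"
    by (rule cycle_decomposable_two_triangles_four_cycle) (use * in simp)
  moreover have "?Q \<inter> ?R = {}"
    using * unfolding triangle_def bipartite_pairs by (simp add: doubleton_edges)
  ultimately have "cycle_decomposable {3, 5} (?Q \<union> ?R)"
    by (metis cycle_decomposable_Un)
  also have "?Q \<union> ?R = piece (Rest w) \<union> (piece (Unit u v 0) \<union> piece (Unit u v 1))"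
    unfolding piece_simps unit_def Let_def triangle_def bipartite_pairs
    by (intro equalityI; use * assms(3) in \<open>simp add: doubleton_edges fibre_def\<close>)
  finally show ?thesis .
qed

text \<open>A row pair misses \<open>c - b\<close> symbol pairs and a column pair misses
  \<open>c - a\<close>. By \<open>capacity\<close>, \<open>exists_balanced_assignment\<close> finds
  a unit of its own for each of them.\<close>

lemma cycle_decomposable_complete_tripartite:
  "cycle_decomposable {3, 5} (edges (complete_tripartite
    (2 * a + of_bool hole) (2 * b + of_bool hole) (2 * c + of_bool hole)))"
proof -
  define I where "I u = {w. w < c \<and> (\<forall>v<b. L u v \<noteq> w)}" for u
  define J where "J v = {w. w < c \<and> (\<forall>u<a. L u v \<noteq> w)}" for v
  have card: "card {w. w < c \<and> (\<forall>x<n. l x \<noteq> w)} = c - n"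
    if "\<And>x. x < n \<Longrightarrow> l x < c" "inj_on l {..<n}" for n and l :: "nat \<Rightarrow> nat"
  proof -
    have "{w. w < c \<and> (\<forall>x<n. l x \<noteq> w)} = {..<c} - l ` {..<n}"
      by auto
    moreover have "l ` {..<n} \<subseteq> {..<c}"
      using that(1) by auto
    ultimately show ?thesis
      using that(2) by (simp add: card_Diff_subset card_image)
  qed
  have I: "finite (I u) \<and> card (I u) = c - b" if "u < a" for u
    using card[of b "L u"] that L_less L_row by (auto simp: I_def inj_on_def)
  have J: "finite (J v) \<and> card (J v) = c - a" if "v < b" for v
    using card[of a "\<lambda>u. L u v"] that L_less L_col by (auto simp: J_def inj_on_def)
  have "c - b + 3 \<le> b"
    using bc cb by linarith
  then obtain f g where
    f: "\<forall>u<a. inj_on (f u) (I u) \<and> (\<forall>w\<in>I u. f u w < b \<and> \<not> F u (f u w))" and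
    g: "\<forall>v<b. inj_on (g v) (J v) \<and> (\<forall>w\<in>J v. fst (g v w) < a \<and> snd (g v w) < (2::nat) \<and>
        \<not> F (fst (g v w)) v \<and> (snd (g v w) = 0 \<longrightarrow> v \<notin> f (fst (g v w)) ` I (fst (g v w))))"
    using exists_balanced_assignment[of a b F "c - b" "c - a" I J, OF F_row F_col _ capacity I J]
    by blast
  define host where "host \<alpha> = (case \<alpha> of
      Row u w \<Rightarrow> {Unit u (f u w) 0}
    | Col v w \<Rightarrow> {Unit (fst (g v w)) v (snd (g v w))}
    | Rest w \<Rightarrow> {Unit (qr w) (qc w) 0, Unit (qr w) (qc w) 1}
    | _ \<Rightarrow> {})" for \<alpha>
  define S where "S = {\<alpha>. valid \<alpha> \<and> (\<exists>u w. \<alpha> = Row u w \<or> \<alpha> = Col u w \<or> \<alpha> = Rest w)}"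
  define U where "U = {\<alpha>. valid \<alpha>} - S"
  have S_cases: thesis if "\<alpha> \<in> S"
    "\<And>u w. \<alpha> = Row u w \<Longrightarrow> u < a \<Longrightarrow> w \<in> I u \<Longrightarrow> thesis"
    "\<And>v w. \<alpha> = Col v w \<Longrightarrow> v < b \<Longrightarrow> w \<in> J v \<Longrightarrow> thesis"
    "\<And>w. \<alpha> = Rest w \<Longrightarrow> hole \<Longrightarrow> w < c \<Longrightarrow> \<forall>v<b. om v \<noteq> w \<Longrightarrow> thesis" for \<alpha> thesis
    using that unfolding S_def I_def J_def by auto
  have valid_unit: "valid (Unit u v e)" if "u < a" "v < b" "\<not> F u v" "e < 2" for u v e
    using that F_diag by auto
  have rest_unit: "valid (Unit (qr w) (qc w) e)" if hole "w < c" "\<forall>v<b. om v \<noteq> w" "e < 2" for w e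
  proof -
    \<comment> \<open>A diagonal subsquare carries a value of \<open>om\<close>, and
      \<open>w\<close> is not one.\<close>
    have "qr w \<noteq> qc w"
      using rest[OF that(1-3)] om_diag[OF that(1), of "qr w"] that(3) by force
    then show ?thesis
      using rest[OF that(1-3)] that(4) by simp
  qed
  have host_valid: "host \<alpha> \<subseteq> {\<beta>. valid \<beta> \<and> (\<exists>u v e. \<beta> = Unit u v e)}" if "\<alpha> \<in> S" for \<alpha>
    using that
  proof (rule S_cases)
    fix u w assume "\<alpha> = Row u w" "u < a" "w \<in> I u"
    then show ?thesis
      using f valid_unit[of u "f u w" 0] by (simp add: host_def)
  next
    fix v w assume "\<alpha> = Col v w" "v < b" "w \<in> J v"
    then show ?thesis
      using g valid_unit[of "fst (g v w)" v "snd (g v w)"] by (simp add: host_def)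
  next
    fix w assume "\<alpha> = Rest w" hole "w < c" "\<forall>v<b. om v \<noteq> w"
    then show ?thesis
      using rest_unit[of w 0] rest_unit[of w 1] by (simp add: host_def)
  qed
  have host_cases: "(\<exists>w\<in>I u. \<alpha> = Row u w \<and> u < a \<and> v = f u w \<and> e = 0) \<or>
      (\<exists>w\<in>J v. \<alpha> = Col v w \<and> v < b \<and> g v w = (u, e)) \<or> \<alpha> = Rest (L u v) \<and> F u v"
    if "\<alpha> \<in> S" "Unit u v e \<in> host \<alpha>" for \<alpha> u v e
    using that(1)
  proof (rule S_cases)
    fix w assume "\<alpha> = Rest w" hole "w < c" "\<forall>v<b. om v \<noteq> w"
    then show ?thesis
      using rest[of w] that(2) by (auto simp: host_def)
  qed (use that(2) in \<open>auto simp: host_def\<close>)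
  have host_inj: "\<alpha> = \<beta>" if "\<alpha> \<in> S" "\<beta> \<in> S" "Unit u v e \<in> host \<alpha>" "Unit u v e \<in> host \<beta>" for \<alpha> \<beta> u v e
  proof -
    have Row: "\<not> F u v" if "w \<in> I u" "u < a" "v = f u w" for w
      using f that by blast
    have Col: "\<not> F u v \<and> (e = 0 \<longrightarrow> v \<notin> f u ` I u)" if "w \<in> J v" "v < b" "g v w = (u, e)" for w
      using g that by (metis fst_conv snd_conv)
    have Row_inj: "w = w'" if "w \<in> I u" "w' \<in> I u" "u < a" "f u w = f u w'" for w w'
      using f that by (meson inj_onD)
    have Col_inj: "w = w'" if "w \<in> J v" "w' \<in> J v" "v < b" "g v w = g v w'" for w w'
      using g that by (meson inj_onD)
    show ?thesis
      \<comment> \<open>\<open>f\<close> and \<open>g\<close> avoid each other at place 0, and both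
        avoid the subsquares marked by \<open>F\<close>, which \<open>Rest\<close> atoms use. Two
        \<open>Rest\<close> atoms with the same subsquare both belong to its entry
        \<open>L u v\<close>.\<close>
      using host_cases[OF that(1,3)] host_cases[OF that(2,4)]
      by (elim disjE bexE conjE) (use Row Col Row_inj Col_inj in \<open>auto\<close>)
  qed
  have "cycle_decomposable {3, 5} (\<Union>\<alpha>\<in>U \<union> S. piece \<alpha>)"
  proof (rule cycle_decomposable_absorb)
    show "disjoint_family_on piece (U \<union> S)"
      unfolding disjoint_family_on_def U_def S_def using piece_disjoint by blast
    show "U \<inter> S = {}"
      by (auto simp: U_def)
    show "host \<alpha> \<subseteq> U" if "\<alpha> \<in> S" for \<alpha>
      using host_valid[OF that] unfolding U_def S_def by auto
    show "host \<alpha> \<inter> host \<beta> = {}" if "\<alpha> \<in> S" "\<beta> \<in> S" "\<alpha> \<noteq> \<beta>" for \<alpha> \<beta>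
      using host_valid[OF that(1)] host_inj[OF that(1,2)] that(3) by blast
    show "cycle_decomposable {3, 5} (piece \<alpha>)" if "\<alpha> \<in> U" for \<alpha>
      using that cycle_decomposable_unit cycle_decomposable_Diag cycle_decomposable_Corner
      by (cases \<alpha>) (auto simp: U_def S_def piece_simps(1))
    show "cycle_decomposable {3, 5} (piece \<alpha> \<union> (\<Union>\<beta>\<in>host \<alpha>. piece \<beta>))" if "\<alpha> \<in> S" for \<alpha>
      using that
    proof (rule S_cases)
      fix u w assume \<alpha>: "\<alpha> = Row u w"
      then show ?thesis
        using host_valid[OF that] that cycle_decomposable_Row[of u w "f u w" 0]
        by (simp add: host_def S_def)
    next
      fix v w assume \<alpha>: "\<alpha> = Col v w"
      then show ?thesis
        using host_valid[OF that] that cycle_decomposable_Col[of v w "fst (g v w)" "snd (g v w)"]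
        by (simp add: host_def S_def)
    next
      fix w assume \<alpha>: "\<alpha> = Rest w" "hole" "w < c" "\<forall>v<b. om v \<noteq> w"
      then show ?thesis
        using host_valid[OF that] that cycle_decomposable_Rest[of w "qr w" "qc w" 0] rest[of w]
        by (simp add: host_def S_def)
    qed
  qed
  also have "U \<union> S = {\<alpha>. valid \<alpha>}"
    by (auto simp: U_def S_def)
  finally show ?thesis
    by (simp only: edges_eq_Union_piece)
qed

end

section \<open>Arrays for each parity, and the conclusion\<close>

text \<open>\<open>8 * a * b\<close> is at most \<open>4 * b * (a + b)\<close>, as
  \<open>a \<le> b\<close>, and at most \<open>2 * (a + b) * (a + b)\<close>, by the inequality of
  means; cancelling \<open>a + b\<close> gives the first two claims. The third amounts to
  \<open>c * (a + b) + 3 * a + 7 * b \<le> 4 * a * b\<close>.\<close>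

lemma block_capacity:
  fixes a b c :: nat
  assumes "0 < a" "a \<le> b" "b \<le> c" "(2 * c + 15) * (a + b) \<le> 8 * a * b"
  shows "c + 3 \<le> 2 * b" "c < a + b" "a * (c - b + 3) + b * (c - a + 7) \<le> 2 * a * b"
proof -
  have "8 * a * b \<le> 4 * b * (a + b)"
    using mult_right_mono[OF \<open>a \<le> b\<close>, of b] by (simp add: algebra_simps)
  then have "(2 * c + 15) * (a + b) \<le> (4 * b) * (a + b)"
    using assms(4) by linarith
  then have "2 * c + 15 \<le> 4 * b"
    using assms(1) by (simp only: mult_le_cancel2)
  then show "c + 3 \<le> 2 * b"
    by linarith
  obtain d where d: "b = a + d"
    using assms(2) le_Suc_ex by blast
  have "8 * a * b \<le> 2 * (a + b) * (a + b)"
    unfolding d by (simp add: algebra_simps)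
  then have "(2 * c + 15) * (a + b) \<le> (2 * (a + b)) * (a + b)"
    using assms(4) by linarith
  then have "2 * c + 15 \<le> 2 * (a + b)"
    using assms(1) by (simp only: mult_le_cancel2)
  then show "c < a + b"
    by simp
  obtain p where p: "c = b + p"
    using assms(3) le_Suc_ex by blast
  have "c - a = d + p" "c - b = p"
    unfolding p d by simp_all
  then show "a * (c - b + 3) + b * (c - a + 7) \<le> 2 * a * b"
    using assms(4) unfolding p d by (simp add: algebra_simps)
qed

lemma cycle_decomposable_even:
  fixes a b c :: nat
  assumes "0 < a" "a \<le> b" "b \<le> c" "(2 * c + 15) * (a + b) \<le> 8 * a * b"
  shows "cycle_decomposable {3, 5} (edges (complete_tripartite (2 * a) (2 * b) (2 * c)))"
proof -
  note cap = block_capacity[OF assms]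
  \<comment> \<open>The cyclic Latin rectangle. The functions \<open>id\<close> are placeholders:
    the conditions on \<open>om\<close>, \<open>qr\<close> and \<open>qc\<close> assume
    \<open>hole\<close>.\<close>
  interpret block_array a b c False "\<lambda>u v. (u + v) mod c" id id id "\<lambda>_ _. False"
  proof
    show "v = v'" if "u < a" "v < b" "v' < b" "(u + v) mod c = (u + v') mod c" for u v v'
      using add_mod_cancel_less[of v u c v'] that assms by (simp add: add.commute)
    show "u = u'" if "u < a" "u' < a" "v < b" "(u + v) mod c = (u' + v) mod c" for u u' v
      using add_mod_cancel_less[of u v c u'] that assms by simp
  qed (use assms cap in auto)
  show ?thesis
    using cycle_decomposable_complete_tripartite by simp
qed

text \<open>The map \<open>\<pi>\<close> skips the value \<open>c div 2\<close> when \<open>c\<close> is even, because the cyclic Latin square of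
  even order has no transversal. This makes the entries \<open>L v v\<close> distinct for \<open>v < b < c\<close>. A symbol
  that is not among them would be the entry \<open>L k k\<close> for \<open>k = pos w \<ge> b\<close>; moving from \<open>(k, k)\<close> along
  the antidiagonal gives the occurrence \<open>(qr w, qc w)\<close> inside the rectangle.\<close>

lemma cycle_decomposable_odd:
  fixes a b c :: nat
  assumes "0 < a" "a \<le> b" "b < c" "(2 * c + 15) * (a + b) \<le> 8 * a * b"
  shows "cycle_decomposable {3, 5} (edges (complete_tripartite (2 * a + 1) (2 * b + 1) (2 * c + 1)))"
proof -
  note cap = block_capacity[OF assms(1,2) less_imp_le[OF assms(3)] assms(4)]
  define \<epsilon> where "\<epsilon> = (if even c then 1 else 0 :: nat)"
  define \<pi> where "\<pi> v = (if c \<le> 2 * v then v + \<epsilon> else v)" for v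
  define L where "L u v = (u + \<pi> v) mod c" for u v
  define pos where "pos w = (w + c - \<epsilon>) div 2" for w
  define qc where "qc w = pos w + b - c" for w
  define qr where "qr w = pos w - b + (if c \<le> 2 * qc w then 0 else \<epsilon>)" for w
  \<comment> \<open>The main diagonal and the two diagonals that contain the cells
    \<open>(qr w, qc w)\<close>, one for each value of the correction in \<open>qr\<close>. Three
    diagonals meet a row or column at most three times.\<close>
  define F where "F u v \<longleftrightarrow> v = u \<or> v + c = 2 * b + u \<or> v + c + 1 = 2 * b + u" for u v
  have \<epsilon>: "\<epsilon> \<le> 1" "even (\<epsilon> + c + 1)"
    by (auto simp: \<epsilon>_def)
  have \<pi>_less: "\<pi> v < c" if "v < b" for v
    using that assms(3) \<epsilon>(1) by (auto simp: \<pi>_def)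
  have \<pi>_inj: "v = v'" if "\<pi> v = \<pi> v'" for v v'
    using that \<epsilon>(1) by (auto simp: \<pi>_def split: if_splits)
  \<comment> \<open>The first branch gives even symbols. The second gives odd ones, since
    \<open>\<epsilon>\<close> and \<open>c\<close> have opposite parity. Hence the diagonal entries
    are distinct.\<close>
  have diag: "L v v = (if 2 * v < c then 2 * v else 2 * v + \<epsilon> - c)" if "v < b" for v
  proof (cases "2 * v < c")
    case True
    then show ?thesis by (simp add: L_def \<pi>_def mult_2)
  next
    case False
    have "(2 * v + \<epsilon>) mod c = 2 * v + \<epsilon> - c"
      using False that assms(3) \<epsilon>(1) by (simp add: mod_if)
    with False show ?thesis
      by (simp add: L_def \<pi>_def mult_2 add.assoc)
  qed
  interpret block_array a b c True L "\<lambda>v. L v v" qr qc F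
  proof
    show "a \<le> b" "b \<le> c" "c + 3 \<le> 2 * b" "a * (c - b + 3) + b * (c - a + 7) \<le> 2 * a * b"
      using assms cap by simp_all
    show "L u v < c" for u v
      using assms(3) by (simp add: L_def)
    show "L v v < c" for v
      using assms(3) by (simp add: L_def)
    show "v = v'" if "u < a" "v < b" "v' < b" "L u v = L u v'" for u v v'
      using add_mod_cancel_less[of "\<pi> v" u c "\<pi> v'"] that \<pi>_less \<pi>_inj
      by (simp add: L_def add.commute)
    show "u = u'" if "u < a" "u' < a" "v < b" "L u v = L u' v" for u u' v
      using add_mod_cancel_less[of u "\<pi> v" c u'] that assms by (simp add: L_def)
    show "L u v \<noteq> L v v" if "v < b" "a \<le> v" "u < a" for u v
      using add_mod_cancel_less[of u "\<pi> v" c v] that assms by (auto simp: L_def)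
    show "v = v'" if "v < b" "v' < b" "L v v = L v' v'" for v v'
      using that(3) \<epsilon>(2) unfolding diag[OF that(1)] diag[OF that(2)]
      by (simp split: if_splits) presburger+
    show "F u u" for u
      by (simp add: F_def)
    show "card {v. v < b \<and> F u v} \<le> 3" for u
    proof -
      have "{v. v < b \<and> F u v} \<subseteq> {u, 2 * b + u - c, 2 * b + u - c - 1}"
        by (auto simp: F_def)
      then have "card {v. v < b \<and> F u v} \<le> card {u, 2 * b + u - c, 2 * b + u - c - 1}"
        by (intro card_mono) auto
      also have "\<dots> \<le> 3"
        by (simp add: card_insert_if)
      finally show ?thesis .
    qed
    show "card {u. u < a \<and> F u v} \<le> 3" for v
    proof -
      have "{u. u < a \<and> F u v} \<subseteq> {v, v + c - 2 * b, v + c + 1 - 2 * b}"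
        by (auto simp: F_def)
      then have "card {u. u < a \<and> F u v} \<le> card {v, v + c - 2 * b, v + c + 1 - 2 * b}"
        by (intro card_mono) auto
      also have "\<dots> \<le> 3"
        by (simp add: card_insert_if)
      finally show ?thesis .
    qed
    show "qr w < a \<and> qc w < b \<and> L (qr w) (qc w) = w \<and> F (qr w) (qc w)"
      if w: "w < c" "\<forall>v<b. L v v \<noteq> w" for w
    proof -
      \<comment> \<open>An even \<open>w\<close> is the entry at \<open>w div 2\<close>, which is
        below \<open>b\<close> because \<open>c < 2 * b\<close>.\<close>
      have "odd w"
      proof
        assume "even w"
        then obtain v where v: "w = 2 * v" by blast
        then have "v < b" "2 * v < c"
          using w(1) cap by linarith+
        then show False
          using w(2) diag[of v] v by auto
      qed
      \<comment> \<open>The division in \<open>pos\<close> is exact for odd \<open>w\<close>, and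
        \<open>pos w\<close> is where the second branch of \<open>diag\<close> takes the value
        \<open>w\<close>.\<close>
      then have pos: "2 * pos w + \<epsilon> = w + c"
        using \<epsilon> unfolding pos_def by presburger
      have "b \<le> pos w"
      proof (rule ccontr)
        assume *: "\<not> b \<le> pos w"
        have "\<not> 2 * pos w < c"
          using pos \<open>odd w\<close> \<epsilon>(1) odd_pos[of w] by linarith
        then have "L (pos w) (pos w) = w"
          using diag[of "pos w"] * pos by simp
        then show False
          using w(2) * by auto
      qed
      moreover have "pos w < c"
        using pos w(1) by linarith
      ultimately have q: "qc w + c = pos w + b" "qc w < b"
        "qr w + b = pos w + (if c \<le> 2 * qc w then 0 else \<epsilon>)"
        using cap unfolding qc_def qr_def by auto
      \<comment> \<open>From \<open>(pos w, pos w)\<close> the column moves back and the row forward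
        by \<open>c - b\<close> modulo \<open>c\<close>. If \<open>qc w\<close> lies in the first
        half, the \<open>\<epsilon>\<close> in \<open>qr\<close> makes up for the shift that
        \<open>\<pi>\<close> no longer performs.\<close>
      have "qr w + \<pi> (qc w) + c = 2 * pos w + \<epsilon>"
        using q by (auto simp: \<pi>_def)
      then have "qr w + \<pi> (qc w) = w"
        using pos by simp
      then have "L (qr w) (qc w) = w"
        using w(1) by (simp add: L_def)
      moreover have "qr w < a"
        using q(3) \<epsilon>(1) \<open>pos w < c\<close> cap(2) by (auto split: if_splits)
      moreover have "F (qr w) (qc w)"
        using q(1,3) \<epsilon>(1) by (auto simp: F_def split: if_splits)
      ultimately show ?thesis
        using q(2) by simp
    qed
  qed auto
  show ?thesis
    using cycle_decomposable_complete_tripartite by simp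
qed

lemma cycle_decomposable_tripartite:
  fixes r s t :: nat
  assumes "0 < r" "r \<le> s" "s \<le> t" "(t + 18) * (r + s) \<le> 4 * r * s"
    and "even r \<longleftrightarrow> even s" "even s \<longleftrightarrow> even t"
  shows "cycle_decomposable {3, 5} (edges (complete_tripartite r s t))"
proof (cases "even t")
  case True
  then obtain a b c where abc: "r = 2 * a" "s = 2 * b" "t = 2 * c"
    using assms(5,6) by (metis evenE)
  have "(2 * c + 18) * (2 * (a + b)) \<le> 2 * (8 * a * b)"
    using assms(4) unfolding abc by (simp add: algebra_simps)
  then have "(2 * c + 15) * (a + b) \<le> 8 * a * b"
    by (simp add: algebra_simps)
  then show ?thesis
    using assms(1-3) unfolding abc by (intro cycle_decomposable_even) auto
next
  case False
  then obtain a b c where abc: "r = 2 * a + 1" "s = 2 * b + 1" "t = 2 * c + 1"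
    using assms(5,6) by (metis oddE)
  \<comment> \<open>The odd \<open>t\<close> turns 18 into 19, and the terms of
    \<open>4 * r * s\<close> linear in \<open>a\<close> and \<open>b\<close> lower it to 15.\<close>
  have c: "(2 * c + 15) * (a + b) + 2 * c + 17 \<le> 8 * a * b"
    using assms(4) unfolding abc by (simp add: algebra_simps)
  then have "0 < a"
    by (intro Nat.gr0I) simp
  show ?thesis
  proof (cases "b = c")
    case True
    have "(2 * b + 15) * (a + b) = 2 * b * b + 2 * a * b + 15 * (a + b)"
      by (simp add: algebra_simps)
    moreover have "(2 * b + 15) * (a + b) + 2 * b + 17 \<le> 8 * a * b"
      using c by (simp only: True)
    \<comment> \<open>Here \<open>s = t\<close>; the remaining inequality yields the bound
      \<open>t \<le> 3 * r\<close> of the cyclic construction.\<close>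
    ultimately have "(2 * b) * b \<le> (6 * a) * b"
      by linarith
    then have "b \<le> 3 * a"
      using \<open>0 < a\<close> assms(2) abc by simp
    then show ?thesis
      using assms(2) \<open>0 < a\<close> unfolding abc True by (intro cycle_decomposable_tripartite_equal) auto
  next
    case False
    then show ?thesis
      using assms(2,3) c \<open>0 < a\<close> unfolding abc by (intro cycle_decomposable_odd) auto
  qed
qed

theorem mainTheorem1:
  fixes r s t :: nat
  assumes "0 < r" and "0 < s" and "0 < t"
    and "r \<le> s" and "s \<le> t"
    and "real t + 18 \<le> 4 * real r * real s / (real r + real s)"
    and "t \<noteq> s + 2"
    and "even r \<longleftrightarrow> even s" and "even s \<longleftrightarrow> even t"
  shows "\<exists>D. cycle_decomposition 5 (complete_tripartite (5 * r) (5 * s) (5 * t)) D"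
proof -
  have "(real t + 18) * (real r + real s) \<le> 4 * real r * real s"
    using assms(1,6) by (simp add: pos_le_divide_eq)
  then have "real ((t + 18) * (r + s)) \<le> real (4 * r * s)"
    by simp
  then have "(t + 18) * (r + s) \<le> 4 * r * s"
    by (simp only: of_nat_le_iff)
  then show ?thesis
    by (intro cycle_decomposition_blow_up_tripartite cycle_decomposable_tripartite) (use assms in auto)
qed

end
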